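(* Let $A$ and $B$ be bialgebras over a field $k$, let $C$ be a $k$-coalgebra, and let $f\colon B\otimes C\to A$ be a partial covering with image $A'=f(B\otimes C)\subseteq A$. Let $\iota\colon A'\to B\otimes C$ be any linear section of $f$, that is, a linear map with $f\circ\iota=\mathrm{id}_{A'}$. Then the following hold. (1) If $p\in B$ is primitive, then for any $c\in C$ the element $f(p\otimes c)$ is primitive in $A'$. (2) If $A'$ (with the structure inherited from $A$) and $B$ are Hopf algebras, with antipodes $S_{A'}$ and $S_B$, then their antipodes are related by the formula $S_{A'}=f\circ(S_B\otimes \mathrm{id}_C)\circ\iota$.
   Context: Let $A,B$ be bialgebras and $C$ a coalgebra over the field $k$. A linear map $f\colon B\otimes C\to A$ is a measuring if for all $b,b'\in B$, $c\in C$: $f(bb'\otimes c)=\sum_{(c)}f(b\otimes c_1)f(b'\otimes c_2)$ and $f(1\otimes c)=\varepsilon(c)1_A$. A partial covering is a measuring $f\colon B\otimes C\to A$ that is also a coalgebra map, where $B\otimes C$ has the tensor product coalgebra structure. An element $p$ is primitive if $\Delta(p)=p\otimes 1+1\otimes p$. Sweedler notation $\Delta(c)=\sum_{(c)}c_1\otimes c_2$ is used. *)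

theory Defs
  imports Complex_Main "HOL-Library.Function_Algebras"
begin

(* A vector space over the field 'k is a linear subspace "carrier V" of an ambient vector space
   structure on the type 'a (take carrier V = UNIV for the whole type).  A linear subspace
   W of V, with whatever structure V carries, is then the record V\<lparr>carrier := W\<rparr>. *)

record ('k, 'a) vspace =
  carrier :: "'a set"
  scale :: "'k \<Rightarrow> 'a \<Rightarrow> 'a"

definition is_vspace :: "('k::field, 'a::ab_group_add, 'm) vspace_scheme \<Rightarrow> bool" where
  "is_vspace V \<longleftrightarrow> vector_space (scale V) \<and> module.subspace (scale V) (carrier V)"

definition linear_map ::
  "('k::field, 'a::ab_group_add, 'm) vspace_scheme \<Rightarrow> ('k, 'b::ab_group_add, 'n) vspace_scheme
    \<Rightarrow> ('a \<Rightarrow> 'b) \<Rightarrow> bool" where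
  "linear_map V W f \<longleftrightarrow>
     (\<forall>x\<in>carrier V. f x \<in> carrier W) \<and>
     (\<forall>x\<in>carrier V. \<forall>y\<in>carrier V. f (x + y) = f x + f y) \<and>
     (\<forall>r. \<forall>x\<in>carrier V. f (scale V r x) = scale W r (f x))"

definition bilinear_map ::
  "('k::field, 'a::ab_group_add, 'm) vspace_scheme \<Rightarrow> ('k, 'b::ab_group_add, 'n) vspace_scheme
    \<Rightarrow> ('k, 'd::ab_group_add, 'l) vspace_scheme \<Rightarrow> ('a \<Rightarrow> 'b \<Rightarrow> 'd) \<Rightarrow> bool" where
  "bilinear_map V W D h \<longleftrightarrow>
     (\<forall>y\<in>carrier W. linear_map V D (\<lambda>x. h x y)) \<and>
     (\<forall>x\<in>carrier V. linear_map W D (h x))"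

definition ground_field :: "('k::field, 'k) vspace" where
  "ground_field = \<lparr>carrier = UNIV, scale = (*)\<rparr>"


section \<open>Tensor products\<close>

(* The tensor product is realised inside the dual of the space of bilinear forms: the pure tensor
   of x and y is evaluation at (x, y), and the tensor product is the span of the pure
   tensors.  Since bilinear forms are taken on the ambient spaces, for subspaces V' of V and
   W' of W the space "tensor V' W'" is literally a subspace of "tensor V W".
   That this has the universal property of the tensor product over a field is proved in
   tensor_universal below. *)

type_synonym ('k, 'a, 'b) tensor = "('a \<Rightarrow> 'b \<Rightarrow> 'k) \<Rightarrow> 'k"

definition bilinear_form ::
  "('k::field, 'a::ab_group_add, 'm) vspace_scheme \<Rightarrow> ('k, 'b::ab_group_add, 'n) vspace_scheme
    \<Rightarrow> ('a \<Rightarrow> 'b \<Rightarrow> 'k) \<Rightarrow> bool" where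
  "bilinear_form V W \<beta> \<longleftrightarrow>
     (\<forall>y. Vector_Spaces.linear (scale V) (*) (\<lambda>x. \<beta> x y)) \<and>
     (\<forall>x. Vector_Spaces.linear (scale W) (*) (\<beta> x))"

definition pure_tensor ::
  "'a::ab_group_add \<Rightarrow> ('k::field, 'a, 'm) vspace_scheme \<Rightarrow>
   ('k, 'b::ab_group_add, 'n) vspace_scheme \<Rightarrow> 'b \<Rightarrow> ('k, 'a, 'b) tensor"
  (\<open>(_ \<otimes>\<^bsub>_,_\<^esub> _)\<close> [76, 0, 0, 76] 75) where
  "x \<otimes>\<^bsub>V,W\<^esub> y = (\<lambda>\<beta>. if bilinear_form V W \<beta> then \<beta> x y else 0)"

definition tensor_scale :: "'k::field \<Rightarrow> ('k, 'a, 'b) tensor \<Rightarrow> ('k, 'a, 'b) tensor" where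
  "tensor_scale r t = (\<lambda>\<beta>. r * t \<beta>)"

definition tensor ::
  "('k::field, 'a::ab_group_add, 'm) vspace_scheme \<Rightarrow> ('k, 'b::ab_group_add, 'n) vspace_scheme
    \<Rightarrow> ('k, ('k, 'a, 'b) tensor) vspace" where
  "tensor V W =
     \<lparr>carrier = module.span tensor_scale {x \<otimes>\<^bsub>V,W\<^esub> y | x y. x \<in> carrier V \<and> y \<in> carrier W},
      scale = tensor_scale\<rparr>"

(* The linear map induced by a bilinear map h: it sends a finite sum of pure tensors
   x \<otimes> y to the sum of the h x y.  See tensor_universal for well-definedness. *)
definition tensor_lift ::
  "('k::field, 'a::ab_group_add, 'm) vspace_scheme \<Rightarrow> ('k, 'b::ab_group_add, 'n) vspace_scheme
    \<Rightarrow> ('a \<Rightarrow> 'b \<Rightarrow> 'd::ab_group_add) \<Rightarrow> ('k, 'a, 'b) tensor \<Rightarrow> 'd" where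
  "tensor_lift V W h t =
     (THE s. \<exists>xs. set xs \<subseteq> carrier V \<times> carrier W \<and>
        t = (\<Sum>(x, y)\<leftarrow>xs. x \<otimes>\<^bsub>V,W\<^esub> y) \<and> s = (\<Sum>(x, y)\<leftarrow>xs. h x y))"

definition tensor_map ::
  "('k::field, 'a::ab_group_add, 'm) vspace_scheme \<Rightarrow> ('k, 'b::ab_group_add, 'n) vspace_scheme
    \<Rightarrow> ('k, 'c::ab_group_add, 'm') vspace_scheme \<Rightarrow> ('k, 'd::ab_group_add, 'n') vspace_scheme
    \<Rightarrow> ('a \<Rightarrow> 'c) \<Rightarrow> ('b \<Rightarrow> 'd) \<Rightarrow> ('k, 'a, 'b) tensor \<Rightarrow> ('k, 'c, 'd) tensor" where
  "tensor_map V W V' W' f g = tensor_lift V W (\<lambda>x y. f x \<otimes>\<^bsub>V',W'\<^esub> g y)"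


section \<open>Coalgebras, bialgebras, Hopf algebras\<close>

record ('k, 'a) coalg = "('k, 'a) vspace" +
  comult :: "'a \<Rightarrow> ('k, 'a, 'a) tensor"
  counit :: "'a \<Rightarrow> 'k"

record ('k, 'a) bialg = "('k, 'a) coalg" +
  mult :: "'a \<Rightarrow> 'a \<Rightarrow> 'a"
  unit :: 'a

(* Sweedler notation: sweedler C h c is the sum over (c) of h c1 c2. *)
definition sweedler ::
  "('k::field, 'a::ab_group_add, 'm) coalg_scheme \<Rightarrow> ('a \<Rightarrow> 'a \<Rightarrow> 'd::ab_group_add) \<Rightarrow> 'a \<Rightarrow> 'd"
where
  "sweedler C h c = tensor_lift C C h (comult C c)"

(* Coassociativity is stated after identifying (C \<otimes> C) \<otimes> C with C \<otimes> (C \<otimes> C). *)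
definition coalgebra :: "('k::field, 'a::ab_group_add, 'm) coalg_scheme \<Rightarrow> bool" where
  "coalgebra C \<longleftrightarrow>
     is_vspace C \<and>
     linear_map C (tensor C C) (comult C) \<and>
     linear_map C ground_field (counit C) \<and>
     (\<forall>c\<in>carrier C.
        sweedler C (\<lambda>c1 c2. sweedler C (\<lambda>c11 c12. c11 \<otimes>\<^bsub>C,tensor C C\<^esub> (c12 \<otimes>\<^bsub>C,C\<^esub> c2)) c1) c =
        sweedler C (\<lambda>c1 c2. c1 \<otimes>\<^bsub>C,tensor C C\<^esub> comult C c2) c) \<and>
     (\<forall>c\<in>carrier C. sweedler C (\<lambda>c1 c2. scale C (counit C c1) c2) c = c) \<and>
     (\<forall>c\<in>carrier C. sweedler C (\<lambda>c1 c2. scale C (counit C c2) c1) c = c)"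

definition coalgebra_map ::
  "('k::field, 'a::ab_group_add, 'm) coalg_scheme \<Rightarrow> ('k, 'b::ab_group_add, 'n) coalg_scheme
    \<Rightarrow> ('a \<Rightarrow> 'b) \<Rightarrow> bool" where
  "coalgebra_map C D f \<longleftrightarrow>
     linear_map C D f \<and>
     (\<forall>c\<in>carrier C. comult D (f c) = tensor_map C C D D f f (comult C c)) \<and>
     (\<forall>c\<in>carrier C. counit D (f c) = counit C c)"

(* (b \<otimes> c) has comultiplication the sum of (b1 \<otimes> c1) \<otimes> (b2 \<otimes> c2). *)
definition tensor_coalg ::
  "('k::field, 'b::ab_group_add, 'm) coalg_scheme \<Rightarrow> ('k, 'c::ab_group_add, 'n) coalg_scheme
    \<Rightarrow> ('k, ('k, 'b, 'c) tensor) coalg" where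
  "tensor_coalg B C = vspace.extend (tensor B C)
     \<lparr>comult = tensor_lift B C (\<lambda>b c.
        sweedler B (\<lambda>b1 b2.
          sweedler C (\<lambda>c1 c2.
            (b1 \<otimes>\<^bsub>B,C\<^esub> c1) \<otimes>\<^bsub>tensor B C,tensor B C\<^esub> (b2 \<otimes>\<^bsub>B,C\<^esub> c2)) c) b),
      counit = tensor_lift B C (\<lambda>b c. counit B b * counit C c)\<rparr>"

definition algebra :: "('k::field, 'a::ab_group_add, 'm) bialg_scheme \<Rightarrow> bool" where
  "algebra A \<longleftrightarrow>
     is_vspace A \<and>
     bilinear_map A A A (mult A) \<and>
     unit A \<in> carrier A \<and>
     (\<forall>x\<in>carrier A. \<forall>y\<in>carrier A. \<forall>z\<in>carrier A.
        mult A (mult A x y) z = mult A x (mult A y z)) \<and>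
     (\<forall>x\<in>carrier A. mult A (unit A) x = x \<and> mult A x (unit A) = x)"

(* The product of the tensor product algebra: (x \<otimes> y) (x' \<otimes> y') = x x' \<otimes> y y'. *)
definition tensor_mult ::
  "('k::field, 'a::ab_group_add, 'm) bialg_scheme
    \<Rightarrow> ('k, 'a, 'a) tensor \<Rightarrow> ('k, 'a, 'a) tensor \<Rightarrow> ('k, 'a, 'a) tensor" where
  "tensor_mult A t u =
     tensor_lift A A (\<lambda>x y. tensor_lift A A (\<lambda>x' y'. mult A x x' \<otimes>\<^bsub>A,A\<^esub> mult A y y') u) t"

definition bialgebra :: "('k::field, 'a::ab_group_add, 'm) bialg_scheme \<Rightarrow> bool" where
  "bialgebra A \<longleftrightarrow>
     algebra A \<and> coalgebra A \<and>
     (\<forall>x\<in>carrier A. \<forall>y\<in>carrier A.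
        comult A (mult A x y) = tensor_mult A (comult A x) (comult A y)) \<and>
     comult A (unit A) = unit A \<otimes>\<^bsub>A,A\<^esub> unit A \<and>
     (\<forall>x\<in>carrier A. \<forall>y\<in>carrier A. counit A (mult A x y) = counit A x * counit A y) \<and>
     counit A (unit A) = 1"

definition hopf_algebra ::
  "('k::field, 'a::ab_group_add, 'm) bialg_scheme \<Rightarrow> ('a \<Rightarrow> 'a) \<Rightarrow> bool" where
  "hopf_algebra H S \<longleftrightarrow>
     bialgebra H \<and> linear_map H H S \<and>
     (\<forall>h\<in>carrier H. sweedler H (\<lambda>h1 h2. mult H (S h1) h2) h = scale H (counit H h) (unit H)) \<and>
     (\<forall>h\<in>carrier H. sweedler H (\<lambda>h1 h2. mult H h1 (S h2)) h = scale H (counit H h) (unit H))"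

definition primitive :: "('k::field, 'a::ab_group_add, 'm) bialg_scheme \<Rightarrow> 'a \<Rightarrow> bool" where
  "primitive H p \<longleftrightarrow>
     p \<in> carrier H \<and> comult H p = p \<otimes>\<^bsub>H,H\<^esub> unit H + unit H \<otimes>\<^bsub>H,H\<^esub> p"


section \<open>Measurings and partial coverings\<close>

definition measuring ::
  "('k::field, 'a::ab_group_add, 'm) bialg_scheme \<Rightarrow> ('k, 'b::ab_group_add, 'n) bialg_scheme
    \<Rightarrow> ('k, 'c::ab_group_add, 'l) coalg_scheme \<Rightarrow> (('k, 'b, 'c) tensor \<Rightarrow> 'a) \<Rightarrow> bool" where
  "measuring A B C f \<longleftrightarrow>
     linear_map (tensor B C) A f \<and>
     (\<forall>b\<in>carrier B. \<forall>b'\<in>carrier B. \<forall>c\<in>carrier C.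
        f (mult B b b' \<otimes>\<^bsub>B,C\<^esub> c) =
        sweedler C (\<lambda>c1 c2. mult A (f (b \<otimes>\<^bsub>B,C\<^esub> c1)) (f (b' \<otimes>\<^bsub>B,C\<^esub> c2))) c) \<and>
     (\<forall>c\<in>carrier C. f (unit B \<otimes>\<^bsub>B,C\<^esub> c) = scale A (counit C c) (unit A))"

definition partial_covering ::
  "('k::field, 'a::ab_group_add, 'm) bialg_scheme \<Rightarrow> ('k, 'b::ab_group_add, 'n) bialg_scheme
    \<Rightarrow> ('k, 'c::ab_group_add, 'l) coalg_scheme \<Rightarrow> (('k, 'b, 'c) tensor \<Rightarrow> 'a) \<Rightarrow> bool" where
  "partial_covering A B C f \<longleftrightarrow> measuring A B C f \<and> coalgebra_map (tensor_coalg B C) A f"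


section \<open>The universal property of the tensor product\<close>

lemma vector_space_tensor_scale: "vector_space (tensor_scale :: 'k::field \<Rightarrow> ('k, 'a, 'b) tensor \<Rightarrow> _)"
  by unfold_locales (auto simp: tensor_scale_def fun_eq_iff algebra_simps)

lemma is_vspace_tensor: "is_vspace (tensor V W)"
proof -
  interpret vector_space "tensor_scale :: 'a \<Rightarrow> ('a, 'b, 'c) tensor \<Rightarrow> _"
    by (rule vector_space_tensor_scale)
  show ?thesis by (simp add: is_vspace_def tensor_def vector_space_tensor_scale)
qed

lemma projection_exists:
  assumes "is_vspace V"
  obtains p where "Vector_Spaces.linear (scale V) (scale V) p" "\<And>x. p x \<in> carrier V"
    "\<And>x. x \<in> carrier V \<Longrightarrow> p x = x"
proof -
  interpret vector_space "scale V" using assms by (simp add: is_vspace_def)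
  interpret vector_space_pair "scale V" "scale V" ..
  have "\<exists>p. p ` UNIV \<subseteq> carrier V \<and> Vector_Spaces.linear (scale V) (scale V) p \<and>
    (\<forall>v\<in>carrier V. p (id v) = v)"
    by (rule linear_exists_left_inverse_on) (use assms linear_id in \<open>auto simp: is_vspace_def id_def\<close>)
  then show ?thesis using that by auto
qed

lemma functional_exists:
  assumes "is_vspace V" "v \<noteq> 0"
  obtains \<phi> where "Vector_Spaces.linear (scale V) (*) \<phi>" "\<phi> v \<noteq> 0"
proof -
  interpret vector_space "scale V" using assms by (simp add: is_vspace_def)
  interpret k: vector_space "(*) :: 'a \<Rightarrow> 'a \<Rightarrow> 'a"
    by unfold_locales (auto simp: algebra_simps)
  interpret vector_space_pair "scale V" "(*) :: 'a \<Rightarrow> 'a \<Rightarrow> 'a" ..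
  have "independent {v}" using assms(2) by simp
  from linear_independent_extend[OF this, of "\<lambda>_. 1"] show ?thesis
    using that by auto
qed

lemma sum_list_pure_tensor:
  "bilinear_form V W \<beta> \<Longrightarrow> (\<Sum>(x, y)\<leftarrow>xs. x \<otimes>\<^bsub>V,W\<^esub> y) \<beta> = (\<Sum>(x, y)\<leftarrow>xs. \<beta> x y)"
  by (induction xs) (auto simp: pure_tensor_def)

lemma sum_list_bilinear_cong:
  assumes V: "is_vspace V" and W: "is_vspace W" and D: "is_vspace D"
    and h: "bilinear_map V W D h"
    and xs: "set xs \<subseteq> carrier V \<times> carrier W" and ys: "set ys \<subseteq> carrier V \<times> carrier W"
    and eq: "(\<Sum>(x, y)\<leftarrow>xs. x \<otimes>\<^bsub>V,W\<^esub> y) = (\<Sum>(x, y)\<leftarrow>ys. x \<otimes>\<^bsub>V,W\<^esub> y)"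
  shows "(\<Sum>(x, y)\<leftarrow>xs. h x y) = (\<Sum>(x, y)\<leftarrow>ys. h x y)"
proof (rule ccontr)
  assume "\<not> ?thesis"
  then have "(\<Sum>(x, y)\<leftarrow>xs. h x y) - (\<Sum>(x, y)\<leftarrow>ys. h x y) \<noteq> 0" by simp
  then obtain \<phi> where \<phi>: "Vector_Spaces.linear (scale D) (*) \<phi>"
    and ne: "\<phi> ((\<Sum>(x, y)\<leftarrow>xs. h x y) - (\<Sum>(x, y)\<leftarrow>ys. h x y)) \<noteq> 0"
    using functional_exists[OF D] by blast
  obtain p where p: "Vector_Spaces.linear (scale V) (scale V) p" "\<And>x. p x \<in> carrier V"
    "\<And>x. x \<in> carrier V \<Longrightarrow> p x = x" using projection_exists[OF V] by blast
  obtain q where q: "Vector_Spaces.linear (scale W) (scale W) q" "\<And>x. q x \<in> carrier W"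
    "\<And>x. x \<in> carrier W \<Longrightarrow> q x = x" using projection_exists[OF W] by blast
  interpret \<phi>: Vector_Spaces.linear "scale D" "(*)" \<phi> by fact
  interpret p: Vector_Spaces.linear "scale V" "scale V" p by fact
  interpret q: Vector_Spaces.linear "scale W" "scale W" q by fact
  define \<beta> where "\<beta> = (\<lambda>x y. \<phi> (h (p x) (q y)))"
  have "bilinear_form V W \<beta>"
    unfolding bilinear_form_def \<beta>_def
  proof (intro conjI allI)
    fix y show "Vector_Spaces.linear (scale V) (*) (\<lambda>x. \<phi> (h (p x) (q y)))"
      by unfold_locales (use h p(2) q(2) in
        \<open>auto simp: bilinear_map_def linear_map_def p.add p.scale \<phi>.add \<phi>.scale algebra_simps\<close>)
  next
    fix x show "Vector_Spaces.linear (scale W) (*) (\<lambda>y. \<phi> (h (p x) (q y)))"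
      by unfold_locales (use h p(2) q(2) in
        \<open>auto simp: bilinear_map_def linear_map_def q.add q.scale \<phi>.add \<phi>.scale algebra_simps\<close>)
  qed
  then have *: "(\<Sum>(x, y)\<leftarrow>xs. \<beta> x y) = (\<Sum>(x, y)\<leftarrow>ys. \<beta> x y)"
    using eq sum_list_pure_tensor by metis
  have **: "(\<Sum>(x, y)\<leftarrow>zs. \<beta> x y) = \<phi> (\<Sum>(x, y)\<leftarrow>zs. h x y)"
    if "set zs \<subseteq> carrier V \<times> carrier W" for zs
    using that by (induction zs) (auto simp: \<beta>_def p(3) q(3) \<phi>.add \<phi>.zero)
  show False using ne * **[OF xs] **[OF ys] by (simp add: \<phi>.diff)
qed

lemma tensor_lift_sum_list:
  assumes "is_vspace V" "is_vspace W" "is_vspace D" "bilinear_map V W D h"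
    and "set xs \<subseteq> carrier V \<times> carrier W"
  shows "tensor_lift V W h (\<Sum>(x, y)\<leftarrow>xs. x \<otimes>\<^bsub>V,W\<^esub> y) = (\<Sum>(x, y)\<leftarrow>xs. h x y)"
  unfolding tensor_lift_def
proof (rule the_equality)
  fix s assume "\<exists>ys. set ys \<subseteq> carrier V \<times> carrier W \<and>
    (\<Sum>(x, y)\<leftarrow>xs. x \<otimes>\<^bsub>V,W\<^esub> y) = (\<Sum>(x, y)\<leftarrow>ys. x \<otimes>\<^bsub>V,W\<^esub> y) \<and> s = (\<Sum>(x, y)\<leftarrow>ys. h x y)"
  then show "s = (\<Sum>(x, y)\<leftarrow>xs. h x y)"
    using sum_list_bilinear_cong[OF assms(1-4) _ assms(5)] by metis
qed (use assms(5) in blast)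

lemma pure_tensor_scale:
  "(scale V r x) \<otimes>\<^bsub>V,W\<^esub> y = tensor_scale r (x \<otimes>\<^bsub>V,W\<^esub> y)"
  by (auto simp: pure_tensor_def tensor_scale_def fun_eq_iff bilinear_form_def
      Vector_Spaces.linear_def module_hom_def module_hom_axioms_def)

lemma sum_list_pure_tensor_scale:
  "(\<Sum>(x, y)\<leftarrow>map (map_prod (scale V r) id) xs. x \<otimes>\<^bsub>V,W\<^esub> y) =
    tensor_scale r (\<Sum>(x, y)\<leftarrow>xs. x \<otimes>\<^bsub>V,W\<^esub> y)"
  by (induction xs) (auto simp: pure_tensor_scale, auto simp: tensor_scale_def fun_eq_iff algebra_simps)

lemma tensor_cases:
  assumes V: "is_vspace V" and t: "t \<in> carrier (tensor V W)"
  obtains xs where "set xs \<subseteq> carrier V \<times> carrier W" "t = (\<Sum>(x, y)\<leftarrow>xs. x \<otimes>\<^bsub>V,W\<^esub> y)"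
proof -
  interpret vector_space "tensor_scale :: 'a \<Rightarrow> ('a, 'b, 'd) tensor \<Rightarrow> _"
    by (rule vector_space_tensor_scale)
  interpret V: vector_space "scale V" using V by (simp add: is_vspace_def)
  have sub: "V.subspace (carrier V)" using V by (simp add: is_vspace_def)
  have "t \<in> span {x \<otimes>\<^bsub>V,W\<^esub> y | x y. x \<in> carrier V \<and> y \<in> carrier W}"
    using t by (simp add: tensor_def)
  then have "\<exists>xs. set xs \<subseteq> carrier V \<times> carrier W \<and> t = (\<Sum>(x, y)\<leftarrow>xs. x \<otimes>\<^bsub>V,W\<^esub> y)"
  proof (induction rule: span_induct_alt)
    case base
    show ?case by (rule exI[of _ "[]"]) simp
  next
    case (step r z t)
    then obtain x y xs where *: "x \<in> carrier V" "y \<in> carrier W" "z = x \<otimes>\<^bsub>V,W\<^esub> y"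
      "set xs \<subseteq> carrier V \<times> carrier W" "t = (\<Sum>(x, y)\<leftarrow>xs. x \<otimes>\<^bsub>V,W\<^esub> y)" by blast
    have "scale V r x \<in> carrier V" using sub *(1) by (rule V.subspace_scale)
    with * show ?case
      by (intro exI[of _ "(scale V r x, y) # xs"]) (simp add: pure_tensor_scale)
  qed
  with that show ?thesis by blast
qed

theorem tensor_universal:
  assumes V: "is_vspace V" and W: "is_vspace W" and D: "is_vspace D"
    and h: "bilinear_map V W D h"
  shows "linear_map (tensor V W) D (tensor_lift V W h)"
    and "\<And>x y. x \<in> carrier V \<Longrightarrow> y \<in> carrier W \<Longrightarrow> tensor_lift V W h (x \<otimes>\<^bsub>V,W\<^esub> y) = h x y"
    and "\<And>F t. linear_map (tensor V W) D F \<Longrightarrow>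
           (\<And>x y. x \<in> carrier V \<Longrightarrow> y \<in> carrier W \<Longrightarrow> F (x \<otimes>\<^bsub>V,W\<^esub> y) = h x y) \<Longrightarrow>
           t \<in> carrier (tensor V W) \<Longrightarrow> F t = tensor_lift V W h t"
proof -
  note lift = tensor_lift_sum_list[OF assms]
  interpret T: vector_space "tensor_scale :: 'a \<Rightarrow> ('a, 'b, 'd) tensor \<Rightarrow> _"
    by (rule vector_space_tensor_scale)
  interpret V: vector_space "scale V" using V by (simp add: is_vspace_def)
  interpret D: vector_space "scale D" using D by (simp add: is_vspace_def)
  have subV: "V.subspace (carrier V)" and subD: "D.subspace (carrier D)"
    using V D by (simp_all add: is_vspace_def)
  have subT: "T.subspace (carrier (tensor V W))" by (simp add: tensor_def)
  have h_in: "h x y \<in> carrier D" if "x \<in> carrier V" "y \<in> carrier W" for x y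
    using h that by (simp add: bilinear_map_def linear_map_def)
  have h_scale: "h (scale V r x) y = scale D r (h x y)" if "x \<in> carrier V" "y \<in> carrier W" for x y r
    using h that by (simp add: bilinear_map_def linear_map_def)
  have sum_in: "(\<Sum>(x, y)\<leftarrow>xs. h x y) \<in> carrier D" if "set xs \<subseteq> carrier V \<times> carrier W" for xs
    using that by (induction xs) (auto intro: D.subspace_add[OF subD] D.subspace_0[OF subD] h_in)
  show "linear_map (tensor V W) D (tensor_lift V W h)"
    unfolding linear_map_def
  proof (intro conjI ballI allI)
    fix t assume "t \<in> carrier (tensor V W)"
    then obtain xs where xs: "set xs \<subseteq> carrier V \<times> carrier W"
      "t = (\<Sum>(x, y)\<leftarrow>xs. x \<otimes>\<^bsub>V,W\<^esub> y)" using tensor_cases[OF V] by blast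
    then show "tensor_lift V W h t \<in> carrier D" by (simp add: lift sum_in)
    fix r
    let ?ys = "map (map_prod (scale V r) id) xs"
    have ys: "set ?ys \<subseteq> carrier V \<times> carrier W"
      using xs(1) by (auto intro: V.subspace_scale[OF subV])
    have "(\<Sum>(x, y)\<leftarrow>?ys. h x y) = scale D r (\<Sum>(x, y)\<leftarrow>xs. h x y)"
      using xs(1) by (induction xs) (auto simp: h_scale D.scale_right_distrib)
    then have "tensor_lift V W h (tensor_scale r t) = scale D r (tensor_lift V W h t)"
      using lift[OF ys] lift[OF xs(1)] xs(2) by (simp only: sum_list_pure_tensor_scale)
    then show "tensor_lift V W h (scale (tensor V W) r t) = scale D r (tensor_lift V W h t)"
      by (simp add: tensor_def)
  next
    fix t u assume "t \<in> carrier (tensor V W)" "u \<in> carrier (tensor V W)"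
    then obtain xs ys where xs: "set xs \<subseteq> carrier V \<times> carrier W" "t = (\<Sum>(x, y)\<leftarrow>xs. x \<otimes>\<^bsub>V,W\<^esub> y)"
      and ys: "set ys \<subseteq> carrier V \<times> carrier W" "u = (\<Sum>(x, y)\<leftarrow>ys. x \<otimes>\<^bsub>V,W\<^esub> y)"
      using tensor_cases[OF V] by metis
    have "set (xs @ ys) \<subseteq> carrier V \<times> carrier W" using xs ys by simp
    from lift[OF this] show "tensor_lift V W h (t + u) = tensor_lift V W h t + tensor_lift V W h u"
      using lift[OF xs(1)] lift[OF ys(1)] xs(2) ys(2) by simp
  qed
  show "tensor_lift V W h (x \<otimes>\<^bsub>V,W\<^esub> y) = h x y" if "x \<in> carrier V" "y \<in> carrier W" for x y
    using lift[of "[(x, y)]"] that by simp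
  fix F t
  assume F: "linear_map (tensor V W) D F"
    and Fh: "\<And>x y. x \<in> carrier V \<Longrightarrow> y \<in> carrier W \<Longrightarrow> F (x \<otimes>\<^bsub>V,W\<^esub> y) = h x y"
    and "t \<in> carrier (tensor V W)"
  then obtain xs where xs: "set xs \<subseteq> carrier V \<times> carrier W"
    "t = (\<Sum>(x, y)\<leftarrow>xs. x \<otimes>\<^bsub>V,W\<^esub> y)" using tensor_cases[OF V] by blast
  have pure_in: "x \<otimes>\<^bsub>V,W\<^esub> y \<in> carrier (tensor V W)" if "x \<in> carrier V" "y \<in> carrier W" for x y
    using that by (auto simp: tensor_def intro!: T.span_base)
  have F_add: "F (t + u) = F t + F u"
    if "t \<in> carrier (tensor V W)" "u \<in> carrier (tensor V W)" for t u
    using F that by (simp add: linear_map_def)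
  have F_0: "F 0 = 0" using F_add[of 0 0] T.subspace_0[OF subT] by simp
  have "(\<Sum>(x, y)\<leftarrow>xs. x \<otimes>\<^bsub>V,W\<^esub> y) \<in> carrier (tensor V W) \<and>
      F (\<Sum>(x, y)\<leftarrow>xs. x \<otimes>\<^bsub>V,W\<^esub> y) = (\<Sum>(x, y)\<leftarrow>xs. h x y)" using xs(1)
    by (induction xs)
      (auto simp: F_0 F_add pure_in Fh T.subspace_0[OF subT] intro: T.subspace_add[OF subT])
  then show "F t = tensor_lift V W h t" using xs lift by simp
qed

end

theory Submission
  imports Defs
begin

text \<open>Everything takes place in convolution algebras. For a coalgebra \<open>C\<close> and an algebra \<open>A\<close> the
  linear maps from \<open>C\<close> to \<open>A\<close> form an algebra \<open>conv_algebra C A\<close> with product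
  \<open>(\<phi> * \<psi>)(c) = \<Sum> \<phi>(c1) \<psi>(c2)\<close> and unit \<open>c \<mapsto> \<epsilon>(c) 1\<close> (\<open>algebra_conv_algebra\<close>; associativity is
  coassociativity of \<open>C\<close>). Because its result is again an algebra, the construction can be
  iterated: currying identifies a linear map on \<open>B \<otimes> C\<close> with an element of
  \<open>conv_algebra B (conv_algebra C A)\<close>, and turns the convolution product over \<open>B \<otimes> C\<close> into the
  product of that algebra (\<open>conv_mult_curried\<close>). Associativity over \<open>B \<otimes> C\<close> is thus obtained
  from the one over \<open>B\<close> and the one over \<open>C\<close>. The two halves of the definition of a partial
  covering \<open>f\<close> now each give a one-sided convolution inverse of \<open>f\<close>.

  A measuring is, after currying, an algebra map from \<open>B\<close> to \<open>conv_algebra C A\<close>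
  (\<open>algebra_map_curried_measuring\<close>). An algebra map \<open>\<phi>\<close> on a Hopf algebra has right convolution
  inverse \<open>\<phi> \<circ> S\<close> (\<open>conv_mult_algebra_map_antipode\<close>), so \<open>f \<circ> (S\<^sub>B \<otimes> id)\<close> is a right inverse of
  \<open>f\<close>. On the other hand \<open>f\<close> is a coalgebra map to a Hopf algebra, and precomposing the antipode
  identity of that Hopf algebra with \<open>f\<close> shows that \<open>S \<circ> f\<close> is a left inverse. A left and
  a right inverse in an associative algebra agree, so \<open>S \<circ> f = f \<circ> (S\<^sub>B \<otimes> id)\<close>
  (\<open>antipode_partial_covering\<close>). This is applied to \<open>f\<close> as a partial covering of its image, and
  evaluated at \<open>\<iota> x\<close>, where \<open>f (\<iota> x) = x\<close>.

  For a primitive \<open>p\<close>, the coproduct of \<open>p \<otimes> c\<close> is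
  \<open>\<Sum> (p \<otimes> c1) \<otimes> (1 \<otimes> c2) + (1 \<otimes> c1) \<otimes> (p \<otimes> c2)\<close>. The map \<open>f \<otimes> f\<close> sends it to the coproduct of
  \<open>f (p \<otimes> c)\<close>, and it replaces \<open>1 \<otimes> ci\<close> by \<open>\<epsilon>(ci) 1\<close>, so the counit law
  leaves \<open>f (p \<otimes> c) \<otimes> 1 + 1 \<otimes> f (p \<otimes> c)\<close> (\<open>primitive_partial_covering\<close>).\<close>


section \<open>Linear and bilinear maps\<close>

lemma vspace_closed:
  assumes "is_vspace V"
  shows "0 \<in> carrier V"
    and "x \<in> carrier V \<Longrightarrow> y \<in> carrier V \<Longrightarrow> x + y \<in> carrier V"
    and "x \<in> carrier V \<Longrightarrow> scale V r x \<in> carrier V"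
proof -
  interpret vector_space "scale V" using assms by (simp add: is_vspace_def)
  have "subspace (carrier V)" using assms by (simp add: is_vspace_def)
  then show "0 \<in> carrier V"
    and "x \<in> carrier V \<Longrightarrow> y \<in> carrier V \<Longrightarrow> x + y \<in> carrier V"
    and "x \<in> carrier V \<Longrightarrow> scale V r x \<in> carrier V"
    by (auto intro: subspace_0 subspace_add subspace_scale)
qed

lemma vspace_scale:
  assumes "is_vspace V"
  shows "scale V r (x + y) = scale V r x + scale V r y"
    and "scale V (r + s) x = scale V r x + scale V s x"
    and "scale V r (scale V s x) = scale V (r * s) x"
    and "scale V r 0 = 0"
    and "scale V 1 x = x"
proof -
  interpret vector_space "scale V" using assms by (simp add: is_vspace_def)
  show "scale V r (x + y) = scale V r x + scale V r y"
    and "scale V (r + s) x = scale V r x + scale V s x"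
    and "scale V r (scale V s x) = scale V (r * s) x"
    and "scale V r 0 = 0"
    and "scale V 1 x = x"
    by (simp_all add: scale_right_distrib scale_left_distrib)
qed

lemma linear_mapD:
  assumes "linear_map V W f"
  shows "x \<in> carrier V \<Longrightarrow> f x \<in> carrier W"
    and "x \<in> carrier V \<Longrightarrow> y \<in> carrier V \<Longrightarrow> f (x + y) = f x + f y"
    and "x \<in> carrier V \<Longrightarrow> f (scale V r x) = scale W r (f x)"
  using assms by (auto simp: linear_map_def)

lemma linear_map_id: "linear_map V V (\<lambda>x. x)"
  by (simp add: linear_map_def)

lemma linear_map_comp:
  "linear_map V W f \<Longrightarrow> linear_map W X g \<Longrightarrow> linear_map V X (\<lambda>x. g (f x))"
  by (simp add: linear_map_def)

lemma linear_map_cong: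
  assumes "is_vspace V" "\<And>x. x \<in> carrier V \<Longrightarrow> f x = g x"
  shows "linear_map V W f \<longleftrightarrow> linear_map V W g"
  using assms(2) vspace_closed[OF assms(1)] by (simp add: linear_map_def)

lemma linear_map_scale_vector:
  "is_vspace W \<Longrightarrow> w \<in> carrier W \<Longrightarrow> linear_map V ground_field \<phi>
    \<Longrightarrow> linear_map V W (\<lambda>x. scale W (\<phi> x) w)"
  by (simp add: linear_map_def ground_field_def vspace_closed vspace_scale)

lemma linear_map_sum_list:
  assumes "is_vspace W" "\<And>x y. (x, y) \<in> set xs \<Longrightarrow> linear_map V W (\<lambda>z. h z x y)"
  shows "linear_map V W (\<lambda>z. \<Sum>(x, y)\<leftarrow>xs. h z x y)"
  using assms(2)
proof (induction xs)
  case Nil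
  then show ?case by (simp add: linear_map_def vspace_closed[OF assms(1)] vspace_scale[OF assms(1)])
next
  case (Cons p xs)
  obtain x y where p: "p = (x, y)" by fastforce
  have "linear_map V W (\<lambda>z. h z x y)" "linear_map V W (\<lambda>z. \<Sum>(x, y)\<leftarrow>xs. h z x y)"
    using Cons by (simp_all add: p)
  then show ?case
    unfolding linear_map_def by (auto simp: p vspace_closed[OF assms(1)] vspace_scale(1)[OF assms(1)])
qed

lemma bilinear_mapI:
  "(\<And>y. y \<in> carrier W \<Longrightarrow> linear_map V D (\<lambda>x. h x y)) \<Longrightarrow>
   (\<And>x. x \<in> carrier V \<Longrightarrow> linear_map W D (\<lambda>y. h x y)) \<Longrightarrow> bilinear_map V W D h"
  by (simp add: bilinear_map_def)

lemma bilinear_mapD: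
  assumes "bilinear_map V W D h"
  shows "y \<in> carrier W \<Longrightarrow> linear_map V D (\<lambda>x. h x y)"
    and "x \<in> carrier V \<Longrightarrow> linear_map W D (\<lambda>y. h x y)"
    and "x \<in> carrier V \<Longrightarrow> y \<in> carrier W \<Longrightarrow> h x y \<in> carrier D"
  using assms by (auto simp: bilinear_map_def linear_map_def)

lemma bilinear_map_comp:
  assumes h: "bilinear_map V W D h" and f: "linear_map V' V f" and g: "linear_map W' W g"
  shows "bilinear_map V' W' D (\<lambda>x y. h (f x) (g y))"
  by (intro bilinear_mapI linear_map_comp[OF f bilinear_mapD(1)[OF h]]
      linear_map_comp[OF g bilinear_mapD(2)[OF h]] linear_mapD(1)[OF f] linear_mapD(1)[OF g])

lemma linear_map_bilinear_map:
  "bilinear_map V W D h \<Longrightarrow> linear_map D E F \<Longrightarrow> bilinear_map V W E (\<lambda>x y. F (h x y))"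
  by (simp add: bilinear_map_def linear_map_def)


section \<open>Lifts to the tensor product\<close>

lemma scale_tensor [simp]: "scale (tensor V W) = tensor_scale"
  by (simp add: tensor_def)

text \<open>A pure tensor is an evaluation functional on bilinear forms of the ambient spaces, so passing to a
  subspace does not change it. This is what allows comparing the coproducts of a bialgebra and of
  its image subspace.\<close>

lemma pure_tensor_cong:
  "scale V = scale V' \<Longrightarrow> scale W = scale W' \<Longrightarrow> x \<otimes>\<^bsub>V,W\<^esub> y = x \<otimes>\<^bsub>V',W'\<^esub> y"
  by (simp add: pure_tensor_def bilinear_form_def)

lemma bilinear_map_pure_tensor: "bilinear_map V W (tensor V W) (\<lambda>x y. x \<otimes>\<^bsub>V,W\<^esub> y)"
proof -
  interpret vector_space "tensor_scale :: 'a \<Rightarrow> ('a, 'b, 'd) tensor \<Rightarrow> _"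
    by (rule vector_space_tensor_scale)
  have pure: "x \<otimes>\<^bsub>V,W\<^esub> y \<in> carrier (tensor V W)" if "x \<in> carrier V" "y \<in> carrier W" for x y
    using that by (auto simp: tensor_def intro!: span_base)
  show ?thesis
    unfolding bilinear_map_def linear_map_def
    by (intro conjI ballI allI)
      (auto simp: pure, auto simp: pure_tensor_def tensor_scale_def fun_eq_iff bilinear_form_def
        Vector_Spaces.linear_def module_hom_def module_hom_axioms_def)
qed

lemmas pure_tensor_in = bilinear_mapD(3)[OF bilinear_map_pure_tensor]

lemma tensor_lift_cong:
  assumes "carrier V = carrier V'" "scale V = scale V'" "carrier W = carrier W'" "scale W = scale W'"
    and "\<And>x y. x \<in> carrier V \<Longrightarrow> y \<in> carrier W \<Longrightarrow> h x y = h' x y"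
  shows "tensor_lift V W h t = tensor_lift V' W' h' t"
proof -
  have "(\<Sum>(x, y)\<leftarrow>xs. h x y) = (\<Sum>(x, y)\<leftarrow>xs. h' x y)"
    if "set xs \<subseteq> carrier V \<times> carrier W" for xs
    using that by (induction xs) (auto simp: assms(5))
  then have "(\<exists>xs. set xs \<subseteq> carrier V \<times> carrier W \<and>
        t = (\<Sum>(x, y)\<leftarrow>xs. x \<otimes>\<^bsub>V,W\<^esub> y) \<and> s = (\<Sum>(x, y)\<leftarrow>xs. h x y)) \<longleftrightarrow>
      (\<exists>xs. set xs \<subseteq> carrier V' \<times> carrier W' \<and>
        t = (\<Sum>(x, y)\<leftarrow>xs. x \<otimes>\<^bsub>V',W'\<^esub> y) \<and> s = (\<Sum>(x, y)\<leftarrow>xs. h' x y))" for s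
    unfolding assms(1,3)[symmetric] pure_tensor_cong[OF assms(2,4), symmetric]
    by (intro ex_cong1) auto
  then show ?thesis by (simp add: tensor_lift_def)
qed

text \<open>Both sides are linear in \<open>t\<close> and agree on pure tensors.\<close>

lemma linear_map_tensor_lift:
  assumes V: "is_vspace V" and W: "is_vspace W" and D: "is_vspace D" and E: "is_vspace E"
    and h: "bilinear_map V W D h" and F: "linear_map D E F" and t: "t \<in> carrier (tensor V W)"
  shows "F (tensor_lift V W h t) = tensor_lift V W (\<lambda>x y. F (h x y)) t"
proof (rule tensor_universal(3)[OF V W E linear_map_bilinear_map[OF h F] _ _ t])
  show "linear_map (tensor V W) E (\<lambda>t. F (tensor_lift V W h t))"
    by (rule linear_map_comp[OF tensor_universal(1)[OF V W D h] F])
qed (simp add: tensor_universal(2)[OF V W D h])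

text \<open>A representation of \<open>t\<close> as a sum of pure tensors can be chosen independently of the parameter
  \<open>z\<close>, so that the lift is a fixed finite sum of maps that are linear in \<open>z\<close>. With this, iterated
  Sweedler sums are seen to be multilinear.\<close>

lemma linear_map_tensor_lift_param:
  assumes V: "is_vspace V" and W: "is_vspace W" and D: "is_vspace D" and Z: "is_vspace Z"
    and t: "t \<in> carrier (tensor V W)"
    and h: "\<And>z. z \<in> carrier Z \<Longrightarrow> bilinear_map V W D (h z)"
    and hz: "\<And>x y. x \<in> carrier V \<Longrightarrow> y \<in> carrier W \<Longrightarrow> linear_map Z D (\<lambda>z. h z x y)"
  shows "linear_map Z D (\<lambda>z. tensor_lift V W (h z) t)"
proof -
  obtain xs where xs: "set xs \<subseteq> carrier V \<times> carrier W" "t = (\<Sum>(x, y)\<leftarrow>xs. x \<otimes>\<^bsub>V,W\<^esub> y)"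
    using tensor_cases[OF V t] by blast
  have "linear_map Z D (\<lambda>z. \<Sum>(x, y)\<leftarrow>xs. h z x y)"
    by (rule linear_map_sum_list[OF D]) (use xs(1) hz in auto)
  moreover have "tensor_lift V W (h z) t = (\<Sum>(x, y)\<leftarrow>xs. h z x y)" if "z \<in> carrier Z" for z
    unfolding xs(2) by (rule tensor_lift_sum_list[OF V W D h[OF that] xs(1)])
  ultimately show ?thesis
    by (subst linear_map_cong[OF Z])
qed


section \<open>Sweedler sums\<close>

lemma coalgebraD:
  assumes "coalgebra C"
  shows "is_vspace C" and "linear_map C (tensor C C) (comult C)"
    and "linear_map C ground_field (counit C)"
    and "c \<in> carrier C \<Longrightarrow> comult C c \<in> carrier (tensor C C)"
  using assms by (auto simp: coalgebra_def linear_map_def)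

lemma sweedler_cong:
  "(\<And>x y. x \<in> carrier C \<Longrightarrow> y \<in> carrier C \<Longrightarrow> h x y = h' x y) \<Longrightarrow> sweedler C h c = sweedler C h' c"
  unfolding sweedler_def by (rule tensor_lift_cong) auto

lemma linear_map_sweedler:
  assumes "coalgebra C" "is_vspace D" "bilinear_map C C D h"
  shows "linear_map C D (sweedler C h)"
  using linear_map_comp[OF coalgebraD(2)[OF assms(1)]
      tensor_universal(1)[OF coalgebraD(1,1)[OF assms(1)] assms(2,3)]]
  by (simp add: sweedler_def [abs_def])

lemma linear_map_apply_sweedler:
  assumes "coalgebra C" "is_vspace D" "is_vspace E" "bilinear_map C C D h" "linear_map D E F"
    "c \<in> carrier C"
  shows "F (sweedler C h c) = sweedler C (\<lambda>x y. F (h x y)) c"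
  unfolding sweedler_def
  by (rule linear_map_tensor_lift[OF coalgebraD(1,1)[OF assms(1)] assms(2-5)
        coalgebraD(4)[OF assms(1,6)]])

lemma linear_map_sweedler_param:
  assumes "coalgebra C" "is_vspace D" "is_vspace Z" "c \<in> carrier C"
    and "\<And>z. z \<in> carrier Z \<Longrightarrow> bilinear_map C C D (h z)"
    and "\<And>x y. x \<in> carrier C \<Longrightarrow> y \<in> carrier C \<Longrightarrow> linear_map Z D (\<lambda>z. h z x y)"
  shows "linear_map Z D (\<lambda>z. sweedler C (h z) c)"
  unfolding sweedler_def
  by (rule linear_map_tensor_lift_param[OF coalgebraD(1,1)[OF assms(1)] assms(2,3)
        coalgebraD(4)[OF assms(1,4)] assms(5,6)])

text \<open>The coassociativity axiom is an identity in \<open>C \<otimes> (C \<otimes> C)\<close>; a trilinear \<open>h\<close> induces a linear map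
  \<open>G\<close> on that space, and applying \<open>G\<close> to the axiom gives the identity for \<open>h\<close>.\<close>

lemma sweedler_coassoc:
  assumes C: "coalgebra C" and D: "is_vspace D" and c: "c \<in> carrier C"
    and h: "\<And>x. x \<in> carrier C \<Longrightarrow> bilinear_map C C D (h x)"
    and hx: "\<And>y z. y \<in> carrier C \<Longrightarrow> z \<in> carrier C \<Longrightarrow> linear_map C D (\<lambda>x. h x y z)"
  shows "sweedler C (\<lambda>x z. sweedler C (\<lambda>x1 x2. h x1 x2 z) x) c =
         sweedler C (\<lambda>x y. sweedler C (h x) y) c"
proof -
  note V = coalgebraD(1)[OF C]
  let ?T = "tensor C C" and ?T3 = "tensor C (tensor C C)"
  note T = is_vspace_tensor[of C C] and T3 = is_vspace_tensor[of C "tensor C C"]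
  define G where "G = tensor_lift C ?T (\<lambda>x t. tensor_lift C C (h x) t)"
  have b: "bilinear_map C ?T D (\<lambda>x t. tensor_lift C C (h x) t)"
    by (intro bilinear_mapI tensor_universal(1)[OF V V D]
        linear_map_tensor_lift_param[OF V V D V] h hx)
  have G: "linear_map ?T3 D G"
    using tensor_universal(1)[OF V T D b] by (simp add: G_def)
  have G_pure: "G (x \<otimes>\<^bsub>C,?T\<^esub> t) = tensor_lift C C (h x) t"
    if "x \<in> carrier C" "t \<in> carrier ?T" for x t
    using tensor_universal(2)[OF V T D b that] by (simp add: G_def)
  have G_pure2: "G (x \<otimes>\<^bsub>C,?T\<^esub> (y \<otimes>\<^bsub>C,C\<^esub> z)) = h x y z"
    if "x \<in> carrier C" "y \<in> carrier C" "z \<in> carrier C" for x y z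
    using that by (simp add: G_pure pure_tensor_in tensor_universal(2)[OF V V D h])
  note pl = bilinear_mapD(1)[OF bilinear_map_pure_tensor] bilinear_mapD(2)[OF bilinear_map_pure_tensor]
  have b1: "bilinear_map C C ?T3 (\<lambda>x1 x2. x1 \<otimes>\<^bsub>C,?T\<^esub> (x2 \<otimes>\<^bsub>C,C\<^esub> z))" if "z \<in> carrier C" for z
    by (rule bilinear_map_comp[OF bilinear_map_pure_tensor linear_map_id pl(1)[OF that]])
  have b2: "bilinear_map C C ?T3 (\<lambda>x z. sweedler C (\<lambda>x1 x2. x1 \<otimes>\<^bsub>C,?T\<^esub> (x2 \<otimes>\<^bsub>C,C\<^esub> z)) x)"
    by (intro bilinear_mapI linear_map_sweedler[OF C T3] linear_map_sweedler_param[OF C T3 V] b1)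
      (auto intro: linear_map_comp[OF pl(2) pl(2)])
  have b3: "bilinear_map C C ?T3 (\<lambda>x y. x \<otimes>\<^bsub>C,?T\<^esub> comult C y)"
    by (rule bilinear_map_comp[OF bilinear_map_pure_tensor linear_map_id coalgebraD(2)[OF C]])
  have "sweedler C (\<lambda>x z. sweedler C (\<lambda>x1 x2. h x1 x2 z) x) c =
        sweedler C (\<lambda>x z. G (sweedler C (\<lambda>x1 x2. x1 \<otimes>\<^bsub>C,?T\<^esub> (x2 \<otimes>\<^bsub>C,C\<^esub> z)) x)) c"
  proof (rule sweedler_cong)
    fix x z assume x: "x \<in> carrier C" and z: "z \<in> carrier C"
    have "G (sweedler C (\<lambda>x1 x2. x1 \<otimes>\<^bsub>C,?T\<^esub> (x2 \<otimes>\<^bsub>C,C\<^esub> z)) x) =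
        sweedler C (\<lambda>x1 x2. G (x1 \<otimes>\<^bsub>C,?T\<^esub> (x2 \<otimes>\<^bsub>C,C\<^esub> z))) x"
      by (rule linear_map_apply_sweedler[OF C T3 D b1[OF z] G x])
    also have "\<dots> = sweedler C (\<lambda>x1 x2. h x1 x2 z) x"
      by (rule sweedler_cong) (simp add: G_pure2 z)
    finally show "sweedler C (\<lambda>x1 x2. h x1 x2 z) x =
        G (sweedler C (\<lambda>x1 x2. x1 \<otimes>\<^bsub>C,?T\<^esub> (x2 \<otimes>\<^bsub>C,C\<^esub> z)) x)" ..
  qed
  also have "\<dots> = G (sweedler C (\<lambda>x z. sweedler C (\<lambda>x1 x2. x1 \<otimes>\<^bsub>C,?T\<^esub> (x2 \<otimes>\<^bsub>C,C\<^esub> z)) x) c)"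
    by (rule linear_map_apply_sweedler[OF C T3 D b2 G c, symmetric])
  also have "\<dots> = G (sweedler C (\<lambda>x y. x \<otimes>\<^bsub>C,?T\<^esub> comult C y) c)"
    using C c by (simp add: coalgebra_def)
  also have "\<dots> = sweedler C (\<lambda>x y. G (x \<otimes>\<^bsub>C,?T\<^esub> comult C y)) c"
    by (rule linear_map_apply_sweedler[OF C T3 D b3 G c])
  also have "\<dots> = sweedler C (\<lambda>x y. sweedler C (h x) y) c"
    by (rule sweedler_cong) (simp add: G_pure coalgebraD(4)[OF C] sweedler_def)
  finally show ?thesis .
qed

text \<open>The counit laws, carried along a linear map \<open>F\<close> by pulling \<open>F\<close> out of the sum.\<close>

lemma sweedler_counit:
  assumes C: "coalgebra C" and D: "is_vspace D" and F: "linear_map C D F" and c: "c \<in> carrier C"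
  shows "sweedler C (\<lambda>x y. scale D (counit C x) (F y)) c = F c"
    and "sweedler C (\<lambda>x y. scale D (counit C y) (F x)) c = F c"
proof -
  note V = coalgebraD(1)[OF C]
  have b: "bilinear_map C C C (\<lambda>x y. scale C (counit C x) y)"
          "bilinear_map C C C (\<lambda>x y. scale C (counit C y) x)"
    using coalgebraD(3)[OF C]
    by (auto simp: bilinear_map_def linear_map_def ground_field_def vspace_closed[OF V]
        vspace_scale[OF V] mult.commute)
  have "sweedler C (\<lambda>x y. scale D (counit C x) (F y)) c = sweedler C (\<lambda>x y. F (scale C (counit C x) y)) c"
    by (rule sweedler_cong) (simp add: linear_mapD(3)[OF F])
  also have "\<dots> = F c"
    using C c by (simp add: linear_map_apply_sweedler[OF C V D b(1) F c, symmetric] coalgebra_def)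
  finally show "sweedler C (\<lambda>x y. scale D (counit C x) (F y)) c = F c" .
  have "sweedler C (\<lambda>x y. scale D (counit C y) (F x)) c = sweedler C (\<lambda>x y. F (scale C (counit C y) x)) c"
    by (rule sweedler_cong) (simp add: linear_mapD(3)[OF F])
  also have "\<dots> = F c"
    using C c by (simp add: linear_map_apply_sweedler[OF C V D b(2) F c, symmetric] coalgebra_def)
  finally show "sweedler C (\<lambda>x y. scale D (counit C y) (F x)) c = F c" .
qed


section \<open>The convolution algebra\<close>

text \<open>The elements of the algebra are functions on the whole type, so they are made to vanish outside
  the carrier: otherwise a linear map on \<open>C\<close> would be represented by many functions and the unit
  laws would fail as equations of functions. The zero coproduct and counit complete the record type
  of which \<open>algebra\<close> is a predicate; a coalgebra structure is not intended.\<close>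

definition conv_algebra ::
  "('k::field, 'c::ab_group_add, 'm) coalg_scheme \<Rightarrow> ('k, 'a::ab_group_add, 'n) bialg_scheme
    \<Rightarrow> ('k, 'c \<Rightarrow> 'a) bialg" where
  "conv_algebra C A =
     \<lparr>carrier = {\<phi>. linear_map C A \<phi> \<and> (\<forall>c. c \<notin> carrier C \<longrightarrow> \<phi> c = 0)},
      scale = (\<lambda>r \<phi> c. scale A r (\<phi> c)),
      comult = (\<lambda>_. 0), counit = (\<lambda>_. 0),
      mult = (\<lambda>\<phi> \<psi> c. if c \<in> carrier C then sweedler C (\<lambda>x y. mult A (\<phi> x) (\<psi> y)) c else 0),
      unit = (\<lambda>c. if c \<in> carrier C then scale A (counit C c) (unit A) else 0)\<rparr>"

lemma conv_algebra_carrier: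
  "\<phi> \<in> carrier (conv_algebra C A) \<longleftrightarrow> linear_map C A \<phi> \<and> (\<forall>c. c \<notin> carrier C \<longrightarrow> \<phi> c = 0)"
  by (simp add: conv_algebra_def)

lemma is_vspace_conv_algebra:
  assumes A: "is_vspace A" and C: "is_vspace C"
  shows "is_vspace (conv_algebra C A)"
proof -
  interpret A: vector_space "scale A" using A by (simp add: is_vspace_def)
  have v: "vector_space (\<lambda>r (\<phi>::'d \<Rightarrow> 'b) c. scale A r (\<phi> c))"
    by unfold_locales (simp_all add: fun_eq_iff A.scale_right_distrib A.scale_left_distrib)
  interpret vector_space "\<lambda>r (\<phi>::'d \<Rightarrow> 'b) c. scale A r (\<phi> c)" by (rule v)
  have "subspace {\<phi>. linear_map C A \<phi> \<and> (\<forall>c. c \<notin> carrier C \<longrightarrow> \<phi> c = 0)}"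
    by (rule subspaceI)
      (auto simp: linear_map_def vspace_closed[OF A] A.scale_right_distrib mult.commute)
  then show ?thesis using v by (simp add: is_vspace_def conv_algebra_def)
qed

lemma linear_map_conv_algebra_eval:
  "c \<in> carrier C \<Longrightarrow> linear_map (conv_algebra C A) A (\<lambda>\<phi>. \<phi> c)"
  by (simp add: linear_map_def conv_algebra_def)

lemma algebraD:
  assumes "algebra A"
  shows "is_vspace A" and "bilinear_map A A A (mult A)" and "unit A \<in> carrier A"
    and "x \<in> carrier A \<Longrightarrow> y \<in> carrier A \<Longrightarrow> z \<in> carrier A \<Longrightarrow>
           mult A (mult A x y) z = mult A x (mult A y z)"
    and "x \<in> carrier A \<Longrightarrow> mult A (unit A) x = x"
    and "x \<in> carrier A \<Longrightarrow> mult A x (unit A) = x"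
  using assms by (auto simp: algebra_def)

lemma mult_scale:
  assumes "algebra A" "x \<in> carrier A" "y \<in> carrier A"
  shows "mult A (scale A r x) y = scale A r (mult A x y)"
    and "mult A x (scale A r y) = scale A r (mult A x y)"
  using linear_mapD(3)[OF bilinear_mapD(1)[OF algebraD(2)[OF assms(1)] assms(3)]]
    linear_mapD(3)[OF bilinear_mapD(2)[OF algebraD(2)[OF assms(1)] assms(2)]] assms(2,3) by auto

lemma conv_mult_in:
  assumes C: "coalgebra C" and A: "algebra A"
    and \<phi>: "\<phi> \<in> carrier (conv_algebra C A)" and \<psi>: "\<psi> \<in> carrier (conv_algebra C A)"
  shows "mult (conv_algebra C A) \<phi> \<psi> \<in> carrier (conv_algebra C A)"
proof -
  have "bilinear_map C C A (\<lambda>x y. mult A (\<phi> x) (\<psi> y))"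
    by (rule bilinear_map_comp[OF algebraD(2)[OF A]]) (use \<phi> \<psi> in \<open>simp_all add: conv_algebra_carrier\<close>)
  note lin = linear_map_sweedler[OF C algebraD(1)[OF A] this]
  have "linear_map C A (mult (conv_algebra C A) \<phi> \<psi>)"
    by (rule iffD2[OF linear_map_cong[OF coalgebraD(1)[OF C]] lin]) (simp add: conv_algebra_def)
  then show ?thesis unfolding conv_algebra_carrier by (simp add: conv_algebra_def)
qed

text \<open>Associativity is coassociativity of \<open>C\<close> applied to the trilinear map
  \<open>\<phi> x \<cdot> (\<psi> y \<cdot> \<chi> z)\<close>, and the unit laws are the counit laws of \<open>C\<close>.\<close>

theorem algebra_conv_algebra:
  assumes C: "coalgebra C" and A: "algebra A"
  shows "algebra (conv_algebra C A)"
  unfolding algebra_def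
proof (intro conjI ballI)
  let ?R = "conv_algebra C A"
  note CV = coalgebraD(1)[OF C] and AV = algebraD(1)[OF A]
  have lin: "linear_map C A \<phi>" if "\<phi> \<in> carrier ?R" for \<phi>
    using that by (simp add: conv_algebra_carrier)
  have inA: "\<phi> x \<in> carrier A" if "\<phi> \<in> carrier ?R" "x \<in> carrier C" for \<phi> x
    using linear_mapD(1)[OF lin] that by blast
  have bil: "bilinear_map C C A (\<lambda>x y. mult A (\<phi> x) (\<psi> y))"
    if "\<phi> \<in> carrier ?R" "\<psi> \<in> carrier ?R" for \<phi> \<psi>
    by (rule bilinear_map_comp[OF algebraD(2)[OF A] lin[OF that(1)] lin[OF that(2)]])
  note mlin = bilinear_mapD(1)[OF algebraD(2)[OF A]] bilinear_mapD(2)[OF algebraD(2)[OF A]]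
    and mult_in = bilinear_mapD(3)[OF algebraD(2)[OF A]]
  show R: "is_vspace ?R" by (rule is_vspace_conv_algebra[OF AV CV])
  have "linear_map C A (unit ?R)"
    by (rule iffD2[OF linear_map_cong[OF CV]
          linear_map_scale_vector[OF AV algebraD(3)[OF A] coalgebraD(3)[OF C]]])
      (simp add: conv_algebra_def)
  then show "unit ?R \<in> carrier ?R"
    unfolding conv_algebra_carrier by (simp add: conv_algebra_def)
  show "bilinear_map ?R ?R ?R (mult ?R)"
  proof -
    have l: "linear_map ?R A (\<lambda>\<phi>. sweedler C (\<lambda>x y. mult A (\<phi> x) (\<psi> y)) c)"
      if "\<psi> \<in> carrier ?R" "c \<in> carrier C" for \<psi> c
      by (rule linear_map_sweedler_param[OF C AV R that(2) bil[OF _ that(1)]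
            linear_map_comp[OF linear_map_conv_algebra_eval mlin(1)[OF inA[OF that(1)]]]])
    have r: "linear_map ?R A (\<lambda>\<psi>. sweedler C (\<lambda>x y. mult A (\<phi> x) (\<psi> y)) c)"
      if "\<phi> \<in> carrier ?R" "c \<in> carrier C" for \<phi> c
      by (rule linear_map_sweedler_param[OF C AV R that(2) bil[OF that(1)]
            linear_map_comp[OF linear_map_conv_algebra_eval mlin(2)[OF inA[OF that(1)]]]])
    have s: "mult ?R \<phi> \<psi> = (\<lambda>c. if c \<in> carrier C
        then sweedler C (\<lambda>x y. mult A (\<phi> x) (\<psi> y)) c else 0)" for \<phi> \<psi>
      by (simp add: conv_algebra_def)
    have sc: "scale ?R = (\<lambda>r \<phi> c. scale A r (\<phi> c))" by (simp add: conv_algebra_def)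
    show ?thesis
    proof (intro bilinear_mapI)
      fix \<psi> assume \<psi>: "\<psi> \<in> carrier ?R"
      show "linear_map ?R ?R (\<lambda>\<phi>. mult ?R \<phi> \<psi>)"
        unfolding linear_map_def
        using conv_mult_in[OF C A _ \<psi>] linear_mapD(2,3)[OF l[OF \<psi>]]
        by (auto simp: s sc fun_eq_iff vspace_scale(4)[OF AV])
    next
      fix \<phi> assume \<phi>: "\<phi> \<in> carrier ?R"
      show "linear_map ?R ?R (\<lambda>\<psi>. mult ?R \<phi> \<psi>)"
        unfolding linear_map_def
        using conv_mult_in[OF C A \<phi>] linear_mapD(2,3)[OF r[OF \<phi>]]
        by (auto simp: s sc fun_eq_iff vspace_scale(4)[OF AV])
    qed
  qed
  fix \<phi> assume \<phi>: "\<phi> \<in> carrier ?R"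
  have \<phi>0: "\<phi> c = 0" if "c \<notin> carrier C" for c
    using \<phi> that by (simp add: conv_algebra_carrier)
  show "mult ?R (unit ?R) \<phi> = \<phi>"
  proof
    fix c
    have "sweedler C (\<lambda>x y. mult A (if x \<in> carrier C then scale A (counit C x) (unit A) else 0) (\<phi> y)) c
        = sweedler C (\<lambda>x y. scale A (counit C x) (\<phi> y)) c"
      by (rule sweedler_cong) (simp add: mult_scale[OF A] algebraD[OF A] inA[OF \<phi>])
    then show "mult ?R (unit ?R) \<phi> c = \<phi> c"
      using sweedler_counit(1)[OF C AV lin[OF \<phi>]] \<phi>0 by (simp add: conv_algebra_def)
  qed
  show "mult ?R \<phi> (unit ?R) = \<phi>"
  proof
    fix c
    have "sweedler C (\<lambda>x y. mult A (\<phi> x) (if y \<in> carrier C then scale A (counit C y) (unit A) else 0)) c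
        = sweedler C (\<lambda>x y. scale A (counit C y) (\<phi> x)) c"
      by (rule sweedler_cong) (simp add: mult_scale[OF A] algebraD[OF A] inA[OF \<phi>])
    then show "mult ?R \<phi> (unit ?R) c = \<phi> c"
      using sweedler_counit(2)[OF C AV lin[OF \<phi>]] \<phi>0 by (simp add: conv_algebra_def)
  qed
  fix \<psi> \<chi> assume \<psi>: "\<psi> \<in> carrier ?R" and \<chi>: "\<chi> \<in> carrier ?R"
  show "mult ?R (mult ?R \<phi> \<psi>) \<chi> = mult ?R \<phi> (mult ?R \<psi> \<chi>)"
  proof
    fix c
    let ?h = "\<lambda>x y z. mult A (\<phi> x) (mult A (\<psi> y) (\<chi> z))"
    have "sweedler C (\<lambda>x z. mult A (sweedler C (\<lambda>x y. mult A (\<phi> x) (\<psi> y)) x) (\<chi> z)) c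
        = sweedler C (\<lambda>x z. sweedler C (\<lambda>x y. ?h x y z) x) c"
    proof (rule sweedler_cong)
      fix x z assume x: "x \<in> carrier C" and z: "z \<in> carrier C"
      have "mult A (sweedler C (\<lambda>x y. mult A (\<phi> x) (\<psi> y)) x) (\<chi> z) =
          sweedler C (\<lambda>x y. mult A (mult A (\<phi> x) (\<psi> y)) (\<chi> z)) x"
        by (rule linear_map_apply_sweedler[OF C AV AV bil[OF \<phi> \<psi>] mlin(1)[OF inA[OF \<chi> z]] x])
      also have "\<dots> = sweedler C (\<lambda>x y. ?h x y z) x"
        by (rule sweedler_cong) (rule algebraD(4)[OF A inA[OF \<phi>] inA[OF \<psi>] inA[OF \<chi> z]])
      finally show "mult A (sweedler C (\<lambda>x y. mult A (\<phi> x) (\<psi> y)) x) (\<chi> z) =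
          sweedler C (\<lambda>x y. ?h x y z) x" .
    qed
    also have "\<dots> = sweedler C (\<lambda>x y. sweedler C (?h x) y) c" if "c \<in> carrier C"
      by (rule sweedler_coassoc[OF C AV that
            linear_map_bilinear_map[OF bil[OF \<psi> \<chi>] mlin(2)[OF inA[OF \<phi>]]]
            linear_map_comp[OF lin[OF \<phi>] mlin(1)[OF mult_in[OF inA[OF \<psi>] inA[OF \<chi>]]]]])
    also have "sweedler C (\<lambda>x y. sweedler C (?h x) y) c
        = sweedler C (\<lambda>x y. mult A (\<phi> x) (sweedler C (\<lambda>x y. mult A (\<psi> x) (\<chi> y)) y)) c"
      by (rule sweedler_cong)
        (rule linear_map_apply_sweedler[OF C AV AV bil[OF \<psi> \<chi>] mlin(2)[OF inA[OF \<phi>]], symmetric])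
    finally have "c \<in> carrier C \<Longrightarrow>
        sweedler C (\<lambda>x z. mult A (sweedler C (\<lambda>x y. mult A (\<phi> x) (\<psi> y)) x) (\<chi> z)) c
        = sweedler C (\<lambda>x y. mult A (\<phi> x) (sweedler C (\<lambda>x y. mult A (\<psi> x) (\<chi> y)) y)) c" .
    moreover have "sweedler C (\<lambda>x z. mult A (mult ?R \<phi> \<psi> x) (\<chi> z)) c =
        sweedler C (\<lambda>x z. mult A (sweedler C (\<lambda>x y. mult A (\<phi> x) (\<psi> y)) x) (\<chi> z)) c"
      "sweedler C (\<lambda>x y. mult A (\<phi> x) (mult ?R \<psi> \<chi> y)) c =
        sweedler C (\<lambda>x y. mult A (\<phi> x) (sweedler C (\<lambda>x y. mult A (\<psi> x) (\<chi> y)) y)) c"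
      by (rule sweedler_cong, simp add: conv_algebra_def)+
    ultimately show "mult ?R (mult ?R \<phi> \<psi>) \<chi> c = mult ?R \<phi> (mult ?R \<psi> \<chi>) c"
      by (simp add: conv_algebra_def)
  qed
qed

text \<open>The usual computation \<open>x = x (y z) = (x y) z = z\<close>.\<close>

lemma algebra_inverse_unique:
  assumes A: "algebra A" and "x \<in> carrier A" "y \<in> carrier A" "z \<in> carrier A"
    and "mult A x y = unit A" "mult A y z = unit A"
  shows "x = z"
  using algebraD(4)[OF A assms(2-4)] algebraD(5,6)[OF A] assms by simp


section \<open>Antipodes as convolution inverses\<close>

definition algebra_map ::
  "('k::field, 'b::ab_group_add, 'm) bialg_scheme \<Rightarrow> ('k, 'a::ab_group_add, 'n) bialg_scheme
    \<Rightarrow> ('b \<Rightarrow> 'a) \<Rightarrow> bool" where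
  "algebra_map B A \<phi> \<longleftrightarrow>
     linear_map B A \<phi> \<and> \<phi> (unit B) = unit A \<and>
     (\<forall>x\<in>carrier B. \<forall>y\<in>carrier B. \<phi> (mult B x y) = mult A (\<phi> x) (\<phi> y))"

lemma hopf_algebraD:
  assumes "hopf_algebra H S"
  shows "algebra H" and "coalgebra H" and "linear_map H H S"
    and "h \<in> carrier H \<Longrightarrow>
      sweedler H (\<lambda>x y. mult H (S x) y) h = scale H (counit H h) (unit H)"
    and "h \<in> carrier H \<Longrightarrow>
      sweedler H (\<lambda>x y. mult H x (S y)) h = scale H (counit H h) (unit H)"
  using assms by (auto simp: hopf_algebra_def bialgebra_def)

text \<open>Since \<open>\<phi>\<close> is multiplicative, \<open>\<Sum> \<phi>(h1) \<phi>(S h2)\<close> is \<open>\<phi>\<close> of \<open>\<Sum> h1 S(h2) = \<epsilon>(h) 1\<close>.\<close>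

lemma conv_mult_algebra_map_antipode:
  assumes H: "hopf_algebra H S" and R: "algebra R" and \<phi>: "algebra_map H R \<phi>"
    and \<psi>: "\<And>x. x \<in> carrier H \<Longrightarrow> \<psi> x = \<phi> (S x)"
  shows "mult (conv_algebra H R) \<phi> \<psi> = unit (conv_algebra H R)"
proof
  fix h
  note A = hopf_algebraD(1)[OF H] and C = hopf_algebraD(2)[OF H] and S = hopf_algebraD(3)[OF H]
  have lin: "linear_map H R \<phi>" using \<phi> by (simp add: algebra_map_def)
  have b: "bilinear_map H H H (\<lambda>x y. mult H x (S y))"
    by (rule bilinear_map_comp[OF algebraD(2)[OF A] linear_map_id S])
  have "sweedler H (\<lambda>x y. mult R (\<phi> x) (\<psi> y)) h = scale R (counit H h) (unit R)"
    if h: "h \<in> carrier H"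
  proof -
    have "sweedler H (\<lambda>x y. mult R (\<phi> x) (\<psi> y)) h = sweedler H (\<lambda>x y. \<phi> (mult H x (S y))) h"
      by (rule sweedler_cong) (use \<phi> linear_mapD(1)[OF S] in \<open>simp add: \<psi> algebra_map_def\<close>)
    also have "\<dots> = \<phi> (sweedler H (\<lambda>x y. mult H x (S y)) h)"
      by (rule linear_map_apply_sweedler[OF C algebraD(1)[OF A] algebraD(1)[OF R] b lin h, symmetric])
    also have "\<dots> = \<phi> (scale H (counit H h) (unit H))"
      by (simp add: hopf_algebraD(5)[OF H h])
    also have "\<dots> = scale R (counit H h) (unit R)"
      using \<phi> by (simp add: linear_mapD(3)[OF lin algebraD(3)[OF A]] algebra_map_def)
    finally show ?thesis .
  qed
  then show "mult (conv_algebra H R) \<phi> \<psi> h = unit (conv_algebra H R) h"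
    by (simp add: conv_algebra_def)
qed

text \<open>The coproduct of \<open>F d\<close> is \<open>\<Sum> F d1 \<otimes> F d2\<close>. The hypotheses on
  \<open>D\<close> are those that make this sum well defined, in a form that \<open>tensor_coalg\<close> satisfies directly
  by the universal property.\<close>

lemma sweedler_coalgebra_map:
  assumes D: "is_vspace D" "comult D d \<in> carrier (tensor D D)" "d \<in> carrier D"
    and A: "is_vspace A" and E: "is_vspace E"
    and F: "coalgebra_map D A F" and h: "bilinear_map A A E h"
  shows "sweedler A h (F d) = sweedler D (\<lambda>x y. h (F x) (F y)) d"
proof -
  have lin: "linear_map D A F" using F by (simp add: coalgebra_map_def)
  have "sweedler A h (F d) =
      tensor_lift A A h (tensor_lift D D (\<lambda>x y. F x \<otimes>\<^bsub>A,A\<^esub> F y) (comult D d))"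
    using F D(3) by (simp add: sweedler_def coalgebra_map_def tensor_map_def)
  also have "\<dots> = tensor_lift D D (\<lambda>x y. tensor_lift A A h (F x \<otimes>\<^bsub>A,A\<^esub> F y)) (comult D d)"
    by (rule linear_map_tensor_lift[OF D(1,1) is_vspace_tensor E
          bilinear_map_comp[OF bilinear_map_pure_tensor lin lin]
          tensor_universal(1)[OF A A E h] D(2)])
  also have "\<dots> = sweedler D (\<lambda>x y. h (F x) (F y)) d"
    unfolding sweedler_def
    by (rule tensor_lift_cong) (simp_all add: tensor_universal(2)[OF A A E h] linear_mapD(1)[OF lin])
  finally show ?thesis .
qed


section \<open>The tensor product coalgebra\<close>

lemma is_vspace_ground_field: "is_vspace (ground_field :: ('k::field, 'k) vspace)"
proof -
  interpret vector_space "(*) :: 'k \<Rightarrow> 'k \<Rightarrow> 'k"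
    by unfold_locales (auto simp: algebra_simps)
  show ?thesis by (simp add: is_vspace_def ground_field_def vector_space_axioms)
qed

text \<open>The coproduct is expressed with the pure tensors of the coalgebra itself in place of those of its
  underlying space, the form in which \<open>sweedler\<close> and \<open>coalgebra_map\<close> refer to it.\<close>

lemma tensor_coalg_simps:
  "carrier (tensor_coalg B C) = carrier (tensor B C)"
  "scale (tensor_coalg B C) = tensor_scale"
  "comult (tensor_coalg B C) = tensor_lift B C (\<lambda>b c.
     sweedler B (\<lambda>b1 b2. sweedler C (\<lambda>c1 c2.
       (b1 \<otimes>\<^bsub>B,C\<^esub> c1) \<otimes>\<^bsub>tensor_coalg B C,tensor_coalg B C\<^esub> (b2 \<otimes>\<^bsub>B,C\<^esub> c2)) c) b)"
  "counit (tensor_coalg B C) = tensor_lift B C (\<lambda>b c. counit B b * counit C c)"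
proof -
  show s: "carrier (tensor_coalg B C) = carrier (tensor B C)"
    "scale (tensor_coalg B C) = tensor_scale"
    "counit (tensor_coalg B C) = tensor_lift B C (\<lambda>b c. counit B b * counit C c)"
    by (simp_all add: tensor_coalg_def vspace.extend_def tensor_def)
  have "t \<otimes>\<^bsub>tensor_coalg B C,tensor_coalg B C\<^esub> u = t \<otimes>\<^bsub>tensor B C,tensor B C\<^esub> u" for t u
    by (rule pure_tensor_cong) (simp_all add: s)
  then show "comult (tensor_coalg B C) = tensor_lift B C (\<lambda>b c.
     sweedler B (\<lambda>b1 b2. sweedler C (\<lambda>c1 c2.
       (b1 \<otimes>\<^bsub>B,C\<^esub> c1) \<otimes>\<^bsub>tensor_coalg B C,tensor_coalg B C\<^esub> (b2 \<otimes>\<^bsub>B,C\<^esub> c2)) c) b)"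
    by (simp add: tensor_coalg_def vspace.extend_def)
qed

lemma is_vspace_tensor_coalg: "is_vspace (tensor_coalg B C)"
  using is_vspace_tensor[of B C] by (simp add: is_vspace_def tensor_coalg_simps)

lemma linear_map_tensor_coalg:
  "linear_map (tensor_coalg B C) A F \<longleftrightarrow> linear_map (tensor B C) A F"
  by (simp add: linear_map_def tensor_coalg_simps)

lemma bilinear_map_pure_tensor_coalg:
  "bilinear_map B C (tensor_coalg B C) (\<lambda>b c. b \<otimes>\<^bsub>B,C\<^esub> c)"
  using bilinear_map_pure_tensor[of B C]
  by (simp add: bilinear_map_def linear_map_def tensor_coalg_simps)

text \<open>Well-definedness of the double Sweedler sums: each bilinearity needed to form or to
  manipulate the sum, first in the inner variables, then in the outer ones, then in \<open>(b, c)\<close>.\<close>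

lemma bilinear_map_double_sweedler:
  assumes B: "coalgebra B" and C: "coalgebra C" and D: "is_vspace D"
    and h: "bilinear_map (tensor_coalg B C) (tensor_coalg B C) D h"
  shows "c \<in> carrier C \<Longrightarrow> bilinear_map B B D
      (\<lambda>b1 b2. sweedler C (\<lambda>c1 c2. h (b1 \<otimes>\<^bsub>B,C\<^esub> c1) (b2 \<otimes>\<^bsub>B,C\<^esub> c2)) c)"
    and "b1 \<in> carrier B \<Longrightarrow> b2 \<in> carrier B \<Longrightarrow>
      bilinear_map C C D (\<lambda>c1 c2. h (b1 \<otimes>\<^bsub>B,C\<^esub> c1) (b2 \<otimes>\<^bsub>B,C\<^esub> c2))"
    and "bilinear_map B C D (\<lambda>b c. sweedler B (\<lambda>b1 b2.
      sweedler C (\<lambda>c1 c2. h (b1 \<otimes>\<^bsub>B,C\<^esub> c1) (b2 \<otimes>\<^bsub>B,C\<^esub> c2)) c) b)"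
proof -
  note BV = coalgebraD(1)[OF B] and CV = coalgebraD(1)[OF C]
  note pl = bilinear_mapD(1)[OF bilinear_map_pure_tensor_coalg]
    and pr = bilinear_mapD(2)[OF bilinear_map_pure_tensor_coalg]
    and pure_in = bilinear_mapD(3)[OF bilinear_map_pure_tensor_coalg]
  have inner: "bilinear_map C C D (\<lambda>c1 c2. h (b1 \<otimes>\<^bsub>B,C\<^esub> c1) (b2 \<otimes>\<^bsub>B,C\<^esub> c2))"
    if "b1 \<in> carrier B" "b2 \<in> carrier B" for b1 b2
    by (rule bilinear_map_comp[OF h pr[OF that(1)] pr[OF that(2)]])
  then show "b1 \<in> carrier B \<Longrightarrow> b2 \<in> carrier B \<Longrightarrow>
      bilinear_map C C D (\<lambda>c1 c2. h (b1 \<otimes>\<^bsub>B,C\<^esub> c1) (b2 \<otimes>\<^bsub>B,C\<^esub> c2))" .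
  have outer: "bilinear_map B B D
      (\<lambda>b1 b2. sweedler C (\<lambda>c1 c2. h (b1 \<otimes>\<^bsub>B,C\<^esub> c1) (b2 \<otimes>\<^bsub>B,C\<^esub> c2)) c)"
    if c: "c \<in> carrier C" for c
  proof (rule bilinear_mapI)
    fix b2 assume b2: "b2 \<in> carrier B"
    show "linear_map B D (\<lambda>b1. sweedler C (\<lambda>c1 c2. h (b1 \<otimes>\<^bsub>B,C\<^esub> c1) (b2 \<otimes>\<^bsub>B,C\<^esub> c2)) c)"
      by (rule linear_map_sweedler_param[OF C D BV c inner[OF _ b2]
            linear_map_comp[OF pl bilinear_mapD(1)[OF h pure_in[OF b2]]]])
  next
    fix b1 assume b1: "b1 \<in> carrier B"
    show "linear_map B D (\<lambda>b2. sweedler C (\<lambda>c1 c2. h (b1 \<otimes>\<^bsub>B,C\<^esub> c1) (b2 \<otimes>\<^bsub>B,C\<^esub> c2)) c)"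
      by (rule linear_map_sweedler_param[OF C D BV c inner[OF b1]
            linear_map_comp[OF pl bilinear_mapD(2)[OF h pure_in[OF b1]]]])
  qed
  then show "c \<in> carrier C \<Longrightarrow> bilinear_map B B D
      (\<lambda>b1 b2. sweedler C (\<lambda>c1 c2. h (b1 \<otimes>\<^bsub>B,C\<^esub> c1) (b2 \<otimes>\<^bsub>B,C\<^esub> c2)) c)" .
  show "bilinear_map B C D (\<lambda>b c. sweedler B (\<lambda>b1 b2.
      sweedler C (\<lambda>c1 c2. h (b1 \<otimes>\<^bsub>B,C\<^esub> c1) (b2 \<otimes>\<^bsub>B,C\<^esub> c2)) c) b)"
  proof (rule bilinear_mapI)
    fix c assume c: "c \<in> carrier C"
    show "linear_map B D (\<lambda>b. sweedler B (\<lambda>b1 b2.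
        sweedler C (\<lambda>c1 c2. h (b1 \<otimes>\<^bsub>B,C\<^esub> c1) (b2 \<otimes>\<^bsub>B,C\<^esub> c2)) c) b)"
      by (rule linear_map_sweedler[OF B D outer[OF c]])
  next
    fix b assume b: "b \<in> carrier B"
    show "linear_map C D (\<lambda>c. sweedler B (\<lambda>b1 b2.
        sweedler C (\<lambda>c1 c2. h (b1 \<otimes>\<^bsub>B,C\<^esub> c1) (b2 \<otimes>\<^bsub>B,C\<^esub> c2)) c) b)"
      by (rule linear_map_sweedler_param[OF B D CV b outer
            linear_map_sweedler[OF C D inner]])
  qed
qed

lemma comult_tensor_coalg_in:
  assumes B: "coalgebra B" and C: "coalgebra C" and t: "t \<in> carrier (tensor B C)"
  shows "comult (tensor_coalg B C) t \<in> carrier (tensor (tensor_coalg B C) (tensor_coalg B C))"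
  unfolding tensor_coalg_simps(3)
  by (rule linear_mapD(1)[OF tensor_universal(1)[OF coalgebraD(1)[OF B] coalgebraD(1)[OF C]
        is_vspace_tensor bilinear_map_double_sweedler(3)[OF B C is_vspace_tensor
          bilinear_map_pure_tensor]] t])

text \<open>The map induced by \<open>h\<close> on the tensor square is linear, hence can be pulled successively into
  the two Sweedler sums that make up the coproduct of \<open>b \<otimes> c\<close>.\<close>

lemma sweedler_tensor_coalg:
  assumes B: "coalgebra B" and C: "coalgebra C" and D: "is_vspace D"
    and h: "bilinear_map (tensor_coalg B C) (tensor_coalg B C) D h"
    and b: "b \<in> carrier B" and c: "c \<in> carrier C"
  shows "sweedler (tensor_coalg B C) h (b \<otimes>\<^bsub>B,C\<^esub> c) =
    sweedler B (\<lambda>b1 b2. sweedler C (\<lambda>c1 c2. h (b1 \<otimes>\<^bsub>B,C\<^esub> c1) (b2 \<otimes>\<^bsub>B,C\<^esub> c2)) c) b"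
proof -
  let ?T = "tensor_coalg B C"
  note BV = coalgebraD(1)[OF B] and CV = coalgebraD(1)[OF C]
    and TV = is_vspace_tensor_coalg[of B C] and TT = is_vspace_tensor[of ?T ?T]
  note dbl = bilinear_map_double_sweedler[OF B C TT bilinear_map_pure_tensor]
  have H: "linear_map (tensor ?T ?T) D (tensor_lift ?T ?T h)"
    by (rule tensor_universal(1)[OF TV TV D h])
  have "sweedler ?T h (b \<otimes>\<^bsub>B,C\<^esub> c) = tensor_lift ?T ?T h
      (sweedler B (\<lambda>b1 b2. sweedler C (\<lambda>c1 c2.
         (b1 \<otimes>\<^bsub>B,C\<^esub> c1) \<otimes>\<^bsub>?T,?T\<^esub> (b2 \<otimes>\<^bsub>B,C\<^esub> c2)) c) b)"
    unfolding sweedler_def[of ?T] tensor_coalg_simps(3)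
    by (simp only: tensor_universal(2)[OF BV CV TT dbl(3) b c])
  also have "\<dots> = sweedler B (\<lambda>b1 b2. tensor_lift ?T ?T h (sweedler C (\<lambda>c1 c2.
         (b1 \<otimes>\<^bsub>B,C\<^esub> c1) \<otimes>\<^bsub>?T,?T\<^esub> (b2 \<otimes>\<^bsub>B,C\<^esub> c2)) c)) b"
    by (rule linear_map_apply_sweedler[OF B TT D dbl(1)[OF c] H b])
  also have "\<dots> = sweedler B (\<lambda>b1 b2. sweedler C (\<lambda>c1 c2. h (b1 \<otimes>\<^bsub>B,C\<^esub> c1) (b2 \<otimes>\<^bsub>B,C\<^esub> c2)) c) b"
  proof (rule sweedler_cong)
    fix b1 b2 assume b12: "b1 \<in> carrier B" "b2 \<in> carrier B"
    have "tensor_lift ?T ?T h (sweedler C (\<lambda>c1 c2. (b1 \<otimes>\<^bsub>B,C\<^esub> c1) \<otimes>\<^bsub>?T,?T\<^esub> (b2 \<otimes>\<^bsub>B,C\<^esub> c2)) c) =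
        sweedler C (\<lambda>c1 c2. tensor_lift ?T ?T h ((b1 \<otimes>\<^bsub>B,C\<^esub> c1) \<otimes>\<^bsub>?T,?T\<^esub> (b2 \<otimes>\<^bsub>B,C\<^esub> c2))) c"
      by (rule linear_map_apply_sweedler[OF C TT D dbl(2)[OF b12] H c])
    also have "\<dots> = sweedler C (\<lambda>c1 c2. h (b1 \<otimes>\<^bsub>B,C\<^esub> c1) (b2 \<otimes>\<^bsub>B,C\<^esub> c2)) c"
      by (rule sweedler_cong)
        (intro tensor_universal(2)[OF TV TV D h] bilinear_mapD(3)[OF bilinear_map_pure_tensor_coalg] b12)
    finally show "tensor_lift ?T ?T h
        (sweedler C (\<lambda>c1 c2. (b1 \<otimes>\<^bsub>B,C\<^esub> c1) \<otimes>\<^bsub>?T,?T\<^esub> (b2 \<otimes>\<^bsub>B,C\<^esub> c2)) c) =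
        sweedler C (\<lambda>c1 c2. h (b1 \<otimes>\<^bsub>B,C\<^esub> c1) (b2 \<otimes>\<^bsub>B,C\<^esub> c2)) c" .
  qed
  finally show ?thesis .
qed

lemma counit_tensor_coalg:
  assumes B: "coalgebra B" and C: "coalgebra C" and "b \<in> carrier B" and "c \<in> carrier C"
  shows "counit (tensor_coalg B C) (b \<otimes>\<^bsub>B,C\<^esub> c) = counit B b * counit C c"
proof -
  have "bilinear_map B C ground_field (\<lambda>b c. counit B b * counit C c)"
    using coalgebraD(3)[OF B] coalgebraD(3)[OF C]
    by (simp add: bilinear_map_def linear_map_def ground_field_def algebra_simps)
  from tensor_universal(2)[OF coalgebraD(1)[OF B] coalgebraD(1)[OF C] is_vspace_ground_field this]
  show ?thesis using assms by (simp add: tensor_coalg_simps)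
qed


section \<open>Currying\<close>

text \<open>The value is \<open>0\<close> outside the carriers, as membership in the iterated convolution algebra demands.\<close>

definition curried ::
  "('k::field, 'b::ab_group_add, 'm) vspace_scheme \<Rightarrow> ('k, 'c::ab_group_add, 'n) vspace_scheme
    \<Rightarrow> (('k, 'b, 'c) tensor \<Rightarrow> 'a::ab_group_add) \<Rightarrow> 'b \<Rightarrow> 'c \<Rightarrow> 'a" where
  "curried B C F = (\<lambda>b c. if b \<in> carrier B \<and> c \<in> carrier C then F (b \<otimes>\<^bsub>B,C\<^esub> c) else 0)"

lemma curried_in_conv_algebra:
  assumes B: "is_vspace B" and C: "is_vspace C" and A: "is_vspace A"
    and F: "linear_map (tensor B C) A F"
  shows "curried B C F \<in> carrier (conv_algebra B (conv_algebra C A))"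
proof -
  note b = linear_map_bilinear_map[OF bilinear_map_pure_tensor F]
  have in1: "curried B C F b \<in> carrier (conv_algebra C A)" if "b \<in> carrier B" for b
  proof -
    have "linear_map C A (curried B C F b)"
      by (rule iffD2[OF linear_map_cong[OF C] bilinear_mapD(2)[OF b that]])
        (simp add: curried_def that)
    then show ?thesis by (simp add: conv_algebra_carrier curried_def)
  qed
  have "linear_map B (conv_algebra C A) (curried B C F)"
    unfolding linear_map_def
    using in1 linear_mapD(2,3)[OF bilinear_mapD(1)[OF b]]
    by (auto simp: curried_def conv_algebra_def fun_eq_iff vspace_closed[OF B] vspace_scale(4)[OF A])
  then show ?thesis by (auto simp: conv_algebra_carrier[of _ B] curried_def fun_eq_iff)
qed

text \<open>Evaluation at \<open>c\<close> is linear, so it can be moved inside the sum over \<open>b\<close>; the product in the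
  inner convolution algebra then supplies the sum over \<open>c\<close>, and the double sum is the one that
  defines the coproduct of \<open>b \<otimes> c\<close>.\<close>

lemma conv_mult_curried:
  assumes B: "coalgebra B" and C: "coalgebra C" and A: "algebra A"
    and F: "linear_map (tensor B C) A F" and G: "linear_map (tensor B C) A G"
    and b: "b \<in> carrier B" and c: "c \<in> carrier C"
  shows "mult (conv_algebra B (conv_algebra C A)) (curried B C F) (curried B C G) b c =
    sweedler (tensor_coalg B C) (\<lambda>s t. mult A (F s) (G t)) (b \<otimes>\<^bsub>B,C\<^esub> c)"
proof -
  let ?R = "conv_algebra C A"
  note BV = coalgebraD(1)[OF B] and CV = coalgebraD(1)[OF C] and AV = algebraD(1)[OF A]
  note R = algebra_conv_algebra[OF C A]
  have lin: "linear_map B ?R (curried B C F)" "linear_map B ?R (curried B C G)"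
    using curried_in_conv_algebra[OF BV CV AV F] curried_in_conv_algebra[OF BV CV AV G]
    by (simp_all add: conv_algebra_carrier[of _ B])
  have h: "bilinear_map (tensor_coalg B C) (tensor_coalg B C) A (\<lambda>s t. mult A (F s) (G t))"
    by (rule bilinear_map_comp[OF algebraD(2)[OF A]]) (simp_all add: linear_map_tensor_coalg F G)
  have "mult (conv_algebra B ?R) (curried B C F) (curried B C G) b c =
      sweedler B (\<lambda>b1 b2. mult ?R (curried B C F b1) (curried B C G b2)) b c"
    using b by (simp add: conv_algebra_def[of B])
  also have "\<dots> = sweedler B (\<lambda>b1 b2. mult ?R (curried B C F b1) (curried B C G b2) c) b"
    by (rule linear_map_apply_sweedler[OF B algebraD(1)[OF R] AV
          bilinear_map_comp[OF algebraD(2)[OF R] lin] linear_map_conv_algebra_eval[OF c] b])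
  also have "\<dots> = sweedler B (\<lambda>b1 b2. sweedler C (\<lambda>c1 c2.
      mult A (F (b1 \<otimes>\<^bsub>B,C\<^esub> c1)) (G (b2 \<otimes>\<^bsub>B,C\<^esub> c2))) c) b"
    by (rule sweedler_cong) (auto simp: conv_algebra_def c curried_def intro!: sweedler_cong)
  also have "\<dots> = sweedler (tensor_coalg B C) (\<lambda>s t. mult A (F s) (G t)) (b \<otimes>\<^bsub>B,C\<^esub> c)"
    by (rule sweedler_tensor_coalg[OF B C AV h b c, symmetric])
  finally show ?thesis .
qed

text \<open>The two measuring axioms are literally multiplicativity and preservation of the unit for the
  convolution product over \<open>C\<close>.\<close>

lemma algebra_map_curried_measuring:
  assumes B: "algebra B" and C: "coalgebra C" and A: "algebra A" and f: "measuring A B C f"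
  shows "algebra_map B (conv_algebra C A) (curried B C f)"
proof -
  note BV = algebraD(1)[OF B] and CV = coalgebraD(1)[OF C] and AV = algebraD(1)[OF A]
  have lin: "linear_map (tensor B C) A f" using f by (simp add: measuring_def)
  have "curried B C f (mult B x y) = mult (conv_algebra C A) (curried B C f x) (curried B C f y)"
    if x: "x \<in> carrier B" and y: "y \<in> carrier B" for x y
  proof
    fix c
    have "sweedler C (\<lambda>c1 c2. mult A (f (x \<otimes>\<^bsub>B,C\<^esub> c1)) (f (y \<otimes>\<^bsub>B,C\<^esub> c2))) c =
        sweedler C (\<lambda>c1 c2. mult A (curried B C f x c1) (curried B C f y c2)) c"
      by (rule sweedler_cong) (simp add: curried_def x y)
    moreover have "curried B C f (mult B x y) c =
        (if c \<in> carrier C then f (mult B x y \<otimes>\<^bsub>B,C\<^esub> c) else 0)"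
      using bilinear_mapD(3)[OF algebraD(2)[OF B] x y] by (simp add: curried_def)
    ultimately show "curried B C f (mult B x y) c =
        mult (conv_algebra C A) (curried B C f x) (curried B C f y) c"
      using f x y by (simp add: conv_algebra_def measuring_def)
  qed
  moreover have "curried B C f (unit B) = unit (conv_algebra C A)"
    using f algebraD(3)[OF B] by (auto simp: curried_def conv_algebra_def measuring_def)
  ultimately show ?thesis
    using curried_in_conv_algebra[OF BV CV AV lin] by (simp add: algebra_map_def conv_algebra_carrier[of _ B])
qed


section \<open>Partial coverings\<close>

text \<open>The map \<open>K\<close> below is the integrand of the sum over \<open>B\<close>, so that the coproduct of \<open>f (p \<otimes> c)\<close> is
  the value on \<open>p \<otimes> 1 + 1 \<otimes> p\<close> of the linear map induced by \<open>K\<close>. In each of the two terms one factor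
  is \<open>f (1 \<otimes> ci) = \<epsilon>(ci) 1\<close>, and the counit law collapses the sum over \<open>C\<close>.\<close>

lemma primitive_partial_covering:
  assumes A: "bialgebra A" and B: "bialgebra B" and C: "coalgebra C"
    and f: "partial_covering A B C f" and p: "primitive B p" and c: "c \<in> carrier C"
  shows "primitive A (f (p \<otimes>\<^bsub>B,C\<^esub> c))"
proof -
  let ?T = "tensor_coalg B C"
  have B': "coalgebra B" "algebra B" and A': "algebra A"
    using A B by (simp_all add: bialgebra_def)
  note BV = algebraD(1)[OF B'(2)] and AV = algebraD(1)[OF A'] and CV = coalgebraD(1)[OF C]
    and AA = is_vspace_tensor[of A A] and oneB = algebraD(3)[OF B'(2)] and oneA = algebraD(3)[OF A']
  have p': "p \<in> carrier B" and \<Delta>p: "comult B p = p \<otimes>\<^bsub>B,B\<^esub> unit B + unit B \<otimes>\<^bsub>B,B\<^esub> p"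
    using p by (simp_all add: primitive_def)
  have lin: "linear_map (tensor B C) A f" and f1: "f (unit B \<otimes>\<^bsub>B,C\<^esub> x) = scale A (counit C x) (unit A)"
    if "x \<in> carrier C" for x
    using f that by (simp_all add: partial_covering_def measuring_def)
  note lin = lin[OF c]
  have fT: "linear_map ?T A f" by (simp add: lin linear_map_tensor_coalg)
  have fp: "linear_map C A (\<lambda>x. f (p \<otimes>\<^bsub>B,C\<^esub> x))"
    by (rule linear_map_comp[OF bilinear_mapD(2)[OF bilinear_map_pure_tensor p'] lin])
  note pl = linear_map_comp[OF fp bilinear_mapD(1)[OF bilinear_map_pure_tensor oneA]]
    and pr = linear_map_comp[OF fp bilinear_mapD(2)[OF bilinear_map_pure_tensor oneA]]
  have h: "bilinear_map ?T ?T (tensor A A) (\<lambda>s t. f s \<otimes>\<^bsub>A,A\<^esub> f t)"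
    by (rule bilinear_map_comp[OF bilinear_map_pure_tensor fT fT])
  define K where "K b1 b2 = sweedler C (\<lambda>c1 c2. f (b1 \<otimes>\<^bsub>B,C\<^esub> c1) \<otimes>\<^bsub>A,A\<^esub> f (b2 \<otimes>\<^bsub>B,C\<^esub> c2)) c" for b1 b2
  have K: "bilinear_map B B (tensor A A) K"
    unfolding K_def [abs_def] by (rule bilinear_map_double_sweedler(1)[OF B'(1) C AA h c])
  have "comult A (f (p \<otimes>\<^bsub>B,C\<^esub> c)) = sweedler ?T (\<lambda>s t. f s \<otimes>\<^bsub>A,A\<^esub> f t) (p \<otimes>\<^bsub>B,C\<^esub> c)"
    using f pure_tensor_in[OF p' c]
    by (simp add: partial_covering_def coalgebra_map_def tensor_map_def sweedler_def tensor_coalg_simps(1))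
  also have "\<dots> = sweedler B K p"
    unfolding K_def [abs_def] by (rule sweedler_tensor_coalg[OF B'(1) C AA h p' c])
  also have "\<dots> = K p (unit B) + K (unit B) p"
    using linear_mapD(2)[OF tensor_universal(1)[OF BV BV AA K]
        pure_tensor_in[OF p' oneB] pure_tensor_in[OF oneB p']]
    by (simp add: sweedler_def \<Delta>p tensor_universal(2)[OF BV BV AA K] p' oneB)
  also have "K p (unit B) = f (p \<otimes>\<^bsub>B,C\<^esub> c) \<otimes>\<^bsub>A,A\<^esub> unit A"
  proof -
    have "K p (unit B) =
        sweedler C (\<lambda>x y. scale (tensor A A) (counit C y) (f (p \<otimes>\<^bsub>B,C\<^esub> x) \<otimes>\<^bsub>A,A\<^esub> unit A)) c"
      unfolding K_def
      by (rule sweedler_cong)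
        (simp only: f1 linear_mapD(3)[OF bilinear_mapD(2)[OF bilinear_map_pure_tensor] oneA]
          linear_mapD(1)[OF fp])
    also have "\<dots> = f (p \<otimes>\<^bsub>B,C\<^esub> c) \<otimes>\<^bsub>A,A\<^esub> unit A"
      by (rule sweedler_counit(2)[OF C AA pl c])
    finally show ?thesis .
  qed
  also have "K (unit B) p = unit A \<otimes>\<^bsub>A,A\<^esub> f (p \<otimes>\<^bsub>B,C\<^esub> c)"
  proof -
    have "K (unit B) p =
        sweedler C (\<lambda>x y. scale (tensor A A) (counit C x) (unit A \<otimes>\<^bsub>A,A\<^esub> f (p \<otimes>\<^bsub>B,C\<^esub> y))) c"
      unfolding K_def by (rule sweedler_cong) (simp only: f1 pure_tensor_scale scale_tensor)
    also have "\<dots> = unit A \<otimes>\<^bsub>A,A\<^esub> f (p \<otimes>\<^bsub>B,C\<^esub> c)"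
      by (rule sweedler_counit(1)[OF C AA pr c])
    finally show ?thesis .
  qed
  finally show ?thesis
    unfolding primitive_def using linear_mapD(1)[OF fp c] by blast
qed

text \<open>In the iterated convolution algebra, the curried forms of \<open>s = S\<^sub>A \<circ> f\<close> and
  \<open>g = f \<circ> (S\<^sub>B \<otimes> id)\<close> are a left and a right inverse of the curried form of \<open>f\<close>: the former
  because \<open>f\<close> is a coalgebra map, the latter because it is a measuring.\<close>

lemma antipode_partial_covering:
  assumes A: "hopf_algebra A S\<^sub>A" and B: "hopf_algebra B S\<^sub>B" and C: "coalgebra C"
    and f: "partial_covering A B C f" and t: "t \<in> carrier (tensor B C)"
  shows "S\<^sub>A (f t) = f (tensor_map B C B C S\<^sub>B (\<lambda>c. c) t)"
proof -
  let ?T = "tensor_coalg B C" and ?R = "conv_algebra C A"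
  let ?Q = "conv_algebra B ?R"
  define g where "g t = f (tensor_map B C B C S\<^sub>B (\<lambda>c. c) t)" for t
  define s where "s t = S\<^sub>A (f t)" for t
  note algA = hopf_algebraD(1)[OF A] and SA = hopf_algebraD(3)[OF A]
    and algB = hopf_algebraD(1)[OF B] and coB = hopf_algebraD(2)[OF B] and SB = hopf_algebraD(3)[OF B]
  note AV = algebraD(1)[OF algA] and BV = algebraD(1)[OF algB] and CV = coalgebraD(1)[OF C]
    and T = is_vspace_tensor[of B C]
  note R = algebra_conv_algebra[OF C algA]
  note Q = algebra_conv_algebra[OF coB R]
  have f_meas: "measuring A B C f" and f_coalg: "coalgebra_map ?T A f"
    using f by (simp_all add: partial_covering_def)
  have f_lin: "linear_map (tensor B C) A f" using f_meas by (simp add: measuring_def)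
  have s_lin: "linear_map (tensor B C) A s"
    unfolding s_def [abs_def] by (rule linear_map_comp[OF f_lin SA])
  have SC: "bilinear_map B C (tensor B C) (\<lambda>b c. S\<^sub>B b \<otimes>\<^bsub>B,C\<^esub> c)"
    by (rule bilinear_map_comp[OF bilinear_map_pure_tensor SB linear_map_id])
  have g_lin: "linear_map (tensor B C) A g"
    unfolding g_def [abs_def] tensor_map_def
    by (rule linear_map_comp[OF tensor_universal(1)[OF BV CV T SC] f_lin])
  have g_pure: "g (b \<otimes>\<^bsub>B,C\<^esub> c) = f (S\<^sub>B b \<otimes>\<^bsub>B,C\<^esub> c)" if "b \<in> carrier B" "c \<in> carrier C" for b c
    unfolding g_def tensor_map_def by (simp add: tensor_universal(2)[OF BV CV T SC that])
  have right: "mult ?Q (curried B C f) (curried B C g) = unit ?Q"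
    by (rule conv_mult_algebra_map_antipode[OF B R algebra_map_curried_measuring[OF algB C algA f_meas]])
      (auto simp: curried_def fun_eq_iff g_pure linear_mapD(1)[OF SB])
  have left: "mult ?Q (curried B C s) (curried B C f) = unit ?Q"
  proof (intro ext)
    fix b c
    have "mult ?Q (curried B C s) (curried B C f) b c = scale A (counit B b * counit C c) (unit A)"
      if b: "b \<in> carrier B" and c: "c \<in> carrier C"
    proof -
      note bc = pure_tensor_in[OF b c]
      have "mult ?Q (curried B C s) (curried B C f) b c =
          sweedler ?T (\<lambda>t u. mult A (S\<^sub>A (f t)) (f u)) (b \<otimes>\<^bsub>B,C\<^esub> c)"
        by (simp add: conv_mult_curried[OF coB C algA s_lin f_lin b c] s_def)
      also have "\<dots> = sweedler A (\<lambda>x y. mult A (S\<^sub>A x) y) (f (b \<otimes>\<^bsub>B,C\<^esub> c))"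
        by (rule sweedler_coalgebra_map[OF is_vspace_tensor_coalg comult_tensor_coalg_in[OF coB C bc]
              _ AV AV f_coalg bilinear_map_comp[OF algebraD(2)[OF algA] SA linear_map_id], symmetric])
          (simp add: bc tensor_coalg_simps)
      also have "\<dots> = scale A (counit A (f (b \<otimes>\<^bsub>B,C\<^esub> c))) (unit A)"
        by (rule hopf_algebraD(4)[OF A linear_mapD(1)[OF f_lin bc]])
      also have "counit A (f (b \<otimes>\<^bsub>B,C\<^esub> c)) = counit B b * counit C c"
        using f_coalg bc counit_tensor_coalg[OF coB C b c]
        by (simp add: coalgebra_map_def tensor_coalg_simps(1))
      finally show ?thesis .
    qed
    moreover have "mult ?Q (curried B C s) (curried B C f) b c = 0"
      if "b \<notin> carrier B \<or> c \<notin> carrier C"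
    proof -
      have "mult ?Q (curried B C s) (curried B C f) \<in> carrier ?Q"
        by (intro conv_mult_in[OF coB R] curried_in_conv_algebra[OF BV CV AV] s_lin f_lin)
      then show ?thesis
        using that linear_mapD(1)[of B ?R _ b] by (cases "b \<in> carrier B") (auto simp: conv_algebra_carrier)
    qed
    ultimately show "mult ?Q (curried B C s) (curried B C f) b c = unit ?Q b c"
      by (auto simp: conv_algebra_def vspace_scale[OF AV])
  qed
  have "curried B C s = curried B C g"
    by (rule algebra_inverse_unique[OF Q _ _ _ left right])
      (intro curried_in_conv_algebra[OF BV CV AV] s_lin f_lin g_lin)+
  then have "s (b \<otimes>\<^bsub>B,C\<^esub> c) = g (b \<otimes>\<^bsub>B,C\<^esub> c)" if "b \<in> carrier B" "c \<in> carrier C" for b c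
    using that by (auto simp: curried_def fun_eq_iff dest!: spec[of _ b] spec[of _ c])
  then have "s t = g t"
    using tensor_universal(3)[OF BV CV AV linear_map_bilinear_map[OF bilinear_map_pure_tensor g_lin] _ _ t,
        of s]
      tensor_universal(3)[OF BV CV AV linear_map_bilinear_map[OF bilinear_map_pure_tensor g_lin] _ _ t,
        of g] s_lin g_lin by simp
  then show ?thesis by (simp add: s_def g_def)
qed

text \<open>Corestriction changes only the carrier. The defining equations of a partial covering take place
  in the ambient space, and the tensor square of the image lies inside that of \<open>A\<close> with the same
  pure tensors.\<close>

lemma partial_covering_image:
  assumes "partial_covering A B C f"
  shows "partial_covering (A\<lparr>carrier := f ` carrier (tensor B C)\<rparr>) B C f"
proof -
  let ?A' = "A\<lparr>carrier := f ` carrier (tensor B C)\<rparr>"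
  have "x \<otimes>\<^bsub>?A',?A'\<^esub> y = x \<otimes>\<^bsub>A,A\<^esub> y" for x y
    by (rule pure_tensor_cong) simp_all
  then show ?thesis
    using assms
    by (simp add: partial_covering_def measuring_def coalgebra_map_def linear_map_def tensor_map_def
        tensor_coalg_simps)
qed

theorem theorem2p4:
  fixes A A' :: "('k::field, 'a::ab_group_add) bialg"
    and B :: "('k, 'b::ab_group_add) bialg"
    and C :: "('k, 'c::ab_group_add) coalg"
    and f :: "('k, 'b, 'c) tensor \<Rightarrow> 'a"
    and \<iota> :: "'a \<Rightarrow> ('k, 'b, 'c) tensor"
  assumes "bialgebra A" and "bialgebra B" and "coalgebra C"
    and "partial_covering A B C f"
    and A'_def: "A' = A\<lparr>carrier := f ` carrier (tensor B C)\<rparr>"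
    and "linear_map A' (tensor B C) \<iota>"
    and "\<forall>x\<in>carrier A'. f (\<iota> x) = x"
  shows "(\<forall>p. primitive B p \<longrightarrow> (\<forall>c\<in>carrier C. primitive A' (f (p \<otimes>\<^bsub>B,C\<^esub> c)))) \<and>
         (\<forall>S\<^sub>A\<^sub>' S\<^sub>B. hopf_algebra A' S\<^sub>A\<^sub>' \<and> hopf_algebra B S\<^sub>B \<longrightarrow>
            (\<forall>x\<in>carrier A'. S\<^sub>A\<^sub>' x = f (tensor_map B C B C S\<^sub>B (\<lambda>c. c) (\<iota> x))))"
proof (intro conjI allI impI ballI)
  fix p c assume p: "primitive B p" and c: "c \<in> carrier C"
  have "x \<otimes>\<^bsub>A',A'\<^esub> y = x \<otimes>\<^bsub>A,A\<^esub> y" for x y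
    by (rule pure_tensor_cong) (simp_all add: A'_def)
  moreover have "f (p \<otimes>\<^bsub>B,C\<^esub> c) \<in> carrier A'"
    using p c by (simp add: A'_def primitive_def pure_tensor_in)
  ultimately show "primitive A' (f (p \<otimes>\<^bsub>B,C\<^esub> c))"
    using primitive_partial_covering[OF assms(1-4) p c] by (simp add: primitive_def A'_def)
next
  fix S\<^sub>A\<^sub>' S\<^sub>B x
  assume H: "hopf_algebra A' S\<^sub>A\<^sub>' \<and> hopf_algebra B S\<^sub>B" and x: "x \<in> carrier A'"
  have "partial_covering A' B C f"
    unfolding A'_def by (rule partial_covering_image[OF assms(4)])
  from antipode_partial_covering[OF conjunct1[OF H] conjunct2[OF H] assms(3) this
      linear_mapD(1)[OF assms(6) x]]
  show "S\<^sub>A\<^sub>' x = f (tensor_map B C B C S\<^sub>B (\<lambda>c. c) (\<iota> x))"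
    using assms(7) x by simp
qed

end
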